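(* Let $\Omega\subset\mathbb R^2$ be a bounded plane region with piecewise smooth boundary. A point $m\in\mathbb R^2$ is the geometric median of $\Omega$ if and only if $$\int_{P\in\partial\Omega}|P-m|\,\overrightarrow{dP}=0.$$
   Context: $|\cdot|$ is the Euclidean norm on $\mathbb R^2$, so $|P-X|$ is the Euclidean distance between the points $P$ and $X$. For a region $\Omega\subset\mathbb R^2$ put $\Sigma_\Omega(X)=\int_{P\in\Omega}|P-X|\,dP$ (integral with respect to area), $X\in\mathbb R^2$. The geometric median of $\Omega$ is the point $m=\mathop{\mathrm{arg\,min}}_{X\in\mathbb R^2}\Sigma_\Omega(X)$. The integral over $\partial\Omega$ is the vector-valued line integral over the boundary of $\Omega$ with its standard (positive) orientation, where $\overrightarrow{dP}$ is the oriented tangential line element: for a piece of the boundary parametrized, compatibly with the orientation, by $P(t)$, $t\in[a,b]$, it contributes $\int_a^b|P(t)-m|\,P'(t)\,dt\in\mathbb R^2$. *)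

theory Defs
  imports "HOL-Complex_Analysis.Complex_Analysis"
begin

text \<open>
  The Euclidean plane is the type \<^typ>\<open>complex\<close>: its distance is the Euclidean distance, its
  Lebesgue measure is area, and multiplication by \<^term>\<open>\<i>\<close> is the counterclockwise rotation by a
  right angle.
\<close>

text \<open>
  A nonempty open set together with none, some or all of its boundary points.  Connectedness is not
  imposed, so the connected regions are a special case.
\<close>

definition plane_region :: "complex set \<Rightarrow> bool" where
  "plane_region \<Omega> \<longleftrightarrow> (\<exists>U. open U \<and> U \<noteq> {} \<and> U \<subseteq> \<Omega> \<and> \<Omega> \<subseteq> closure U)"

definition dist_integral :: "complex set \<Rightarrow> complex \<Rightarrow> real" where
  "dist_integral \<Omega> X = (LINT P:\<Omega>|lebesgue. dist P X)"

text \<open>``The'' minimizer: the set of minimizers is exactly \<open>{m}\<close>.\<close>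

definition is_geometric_median :: "complex set \<Rightarrow> complex \<Rightarrow> bool" where
  "is_geometric_median \<Omega> m \<longleftrightarrow> {X. is_arg_min (dist_integral \<Omega>) (\<lambda>_. True) X} = {m}"

text \<open>
  A regular \<open>C\<^sup>1\<close> curve on \<open>[0,1]\<close> without self-intersections, except that it may be closed.  The
  library predicate \<^const>\<open>C1_differentiable_on\<close> is not used because it constrains the
  function outside \<open>[0,1]\<close>; here derivatives at the endpoints are one-sided.
\<close>

definition smooth_piece :: "(real \<Rightarrow> complex) \<Rightarrow> bool" where
  "smooth_piece \<gamma> \<longleftrightarrow> simple_path \<gamma> \<and>
     (\<exists>D. continuous_on {0..1} D \<and>
          (\<forall>t\<in>{0..1}. (\<gamma> has_vector_derivative D t) (at t within {0..1}) \<and> D t \<noteq> 0))"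

text \<open>
  \<open>\<Gamma>\<close> parametrizes the boundary of \<open>\<Omega>\<close> by finitely many smooth pieces that overlap at most in
  endpoints.  Positive orientation: when a piece is traversed, \<open>\<Omega>\<close> lies on its left and the complement
  of \<open>\<Omega>\<close> on its right.  The boundary may have several components, each with its own pieces.
\<close>

definition positively_oriented_boundary ::
    "complex set \<Rightarrow> (real \<Rightarrow> complex) set \<Rightarrow> bool" where
  "positively_oriented_boundary \<Omega> \<Gamma> \<longleftrightarrow>
     finite \<Gamma> \<and> (\<forall>\<gamma>\<in>\<Gamma>. smooth_piece \<gamma>) \<and>
     frontier \<Omega> = (\<Union>\<gamma>\<in>\<Gamma>. path_image \<gamma>) \<and>
     (\<forall>\<gamma>\<in>\<Gamma>. \<forall>\<delta>\<in>\<Gamma>. \<gamma> \<noteq> \<delta> \<longrightarrow>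
        path_image \<gamma> \<inter> path_image \<delta>
          \<subseteq> {pathstart \<gamma>, pathfinish \<gamma>} \<inter> {pathstart \<delta>, pathfinish \<delta>}) \<and>
     (\<forall>\<gamma>\<in>\<Gamma>. \<forall>t\<in>{0<..<1}. \<forall>\<^sub>F s in at_right 0.
        \<gamma> t + of_real s * (\<i> * vector_derivative \<gamma> (at t)) \<in> \<Omega> \<and>
        \<gamma> t - of_real s * (\<i> * vector_derivative \<gamma> (at t)) \<notin> \<Omega>)"

text \<open>
  For a real-valued \<open>f\<close>, the contour integral of \<open>f\<close> over \<open>\<gamma>\<close> is the integral of
  \<open>f (\<gamma> t) *\<^sub>R \<gamma>' t\<close> over \<open>[0,1]\<close>, that is, the vector-valued line integral of \<open>f\<close> against the
  tangential line element.
\<close>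

definition boundary_integral :: "(real \<Rightarrow> complex) set \<Rightarrow> (complex \<Rightarrow> real) \<Rightarrow> complex" where
  "boundary_integral \<Gamma> f = (\<Sum>\<gamma>\<in>\<Gamma>. contour_integral \<gamma> (\<lambda>P. complex_of_real (f P)))"

end

(*
  The gradient of X |-> int_Omega |P - X| dP at m is -int_Omega sgn (P - m) dP, and by Green's formula
  the boundary integral of |P - m| is i * int_Omega sgn (P - m) dP; so the boundary integral vanishes
  exactly at critical points.  The function is strictly convex: integrating the subgradient inequality
  |P - X| >= |P - m| - <sgn (P - m), X - m>, which is strict off the line through m and X, shows that a
  critical point is the only minimizer.

  Green's formula for such a general boundary is localized with bump functions.  Near a regular
  boundary point the region is one side of a C^1 curve gamma, and the coordinates gamma t + s n
  straighten it.  The corners (arbitrary, cusps included) and the singularity m of |P - m| are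
  isolated points, which do not matter for a function with bounded gradient.
*)
theory Submission
  imports Defs
begin

section \<open>Change of variables in the plane\<close>

text \<open>Differentiation under the integral sign is avoided. The subgradient inequality at
  \<open>m\<close> gives sufficiency; for necessity it is applied at points tending to
  \<open>m\<close> along \<open>H m\<close>, where \<open>H X\<close> is the integral of
  \<open>sgn (P - X)\<close>, and only the convergence of \<open>H\<close> along such points is
  needed. The obstacle in Green's formula is that orientation is given separately on the normal line
  of each boundary point, with no uniform width. Compactness keeps the rest of the boundary away
  from a regular point, and connectedness spreads the information from one normal line to a whole
  side of the curve. The coordinates use one fixed vector \<open>n\<close>, the normal at the base
  point: a normal turning with \<open>t\<close> would require a derivative of the tangent, which a
  C^1 curve does not have.\<close>

lemma has_integral_measure_preserving:
  fixes g :: "'a::euclidean_space \<Rightarrow> 'b::euclidean_space" and f :: "'b \<Rightarrow> 'c::banach"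
  assumes hg: "\<And>x. h (g x) = x" and gh: "\<And>x. g (h x) = x"
    and contg: "\<And>x. continuous (at x) g"
    and g: "\<And>u v. \<exists>w z. g ` cbox u v = cbox w z"
    and h: "\<And>u v. \<exists>w z. h ` cbox u v = cbox w z"
    and content: "\<And>u v. measure lborel (g ` cbox u v) = measure lborel (cbox u v)"
    and f: "(f has_integral i) S" and "bounded S"
  shows "((\<lambda>x. f (g x)) has_integral i) (h ` S)"
proof -
  obtain c where c: "S \<subseteq> cbox (-c) c"
    using bounded_subset_cbox_symmetric[OF \<open>bounded S\<close>] by blast
  \<comment> \<open>The twiddle rule transports integrals over boxes, so \<open>f\<close> is
    extended by zero to a box containing the bounded set \<open>S\<close>; the factor
    \<open>1\<close> below is the volume ratio.\<close>
  have "((\<lambda>x. if x \<in> S then f x else 0) has_integral i) (cbox (-c) c)"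
    using f by (simp only: has_integral_restrict[OF c])
  from has_integral_twiddle[of 1 h g, OF _ hg gh contg g h _ this]
  have "((\<lambda>x. if g x \<in> S then f (g x) else 0) has_integral i) (h ` cbox (-c) c)"
    using content by simp
  moreover have "g x \<in> S \<longleftrightarrow> x \<in> h ` S" for x
    by (metis (no_types, lifting) hg gh image_iff)
  ultimately have "((\<lambda>x. if x \<in> h ` S then f (g x) else 0) has_integral i) (h ` cbox (-c) c)"
    by simp
  moreover have "h ` S \<subseteq> h ` cbox (-c) c"
    using c by blast
  ultimately show ?thesis
    using h by (metis has_integral_restrict)
qed

text \<open>The library states the change of variables theorem for \<open>real^n\<close> and iterated integrals for
  product types, so integrals are carried between \<open>complex\<close>, \<open>real^2\<close> and \<open>real \<times> real\<close>.\<close>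

definition vec2_of_complex :: "complex \<Rightarrow> real^2" where
  "vec2_of_complex z = vector [Re z, Im z]"

definition complex_of_vec2 :: "real^2 \<Rightarrow> complex" where
  "complex_of_vec2 v = Complex (vec_nth v 1) (vec_nth v 2)"

definition vec2_of_pair :: "real \<times> real \<Rightarrow> real^2" where
  "vec2_of_pair p = vector [fst p, snd p]"

definition pair_of_vec2 :: "real^2 \<Rightarrow> real \<times> real" where
  "pair_of_vec2 v = (vec_nth v 1, vec_nth v 2)"

lemma vec2_of_complex_nth [simp]:
  "vec_nth (vec2_of_complex z) 1 = Re z" "vec_nth (vec2_of_complex z) 2 = Im z"
  by (simp_all add: vec2_of_complex_def)

lemma vec2_of_pair_nth [simp]:
  "vec_nth (vec2_of_pair p) 1 = fst p" "vec_nth (vec2_of_pair p) 2 = snd p"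
  by (simp_all add: vec2_of_pair_def)

lemma pair_of_vec2_simps [simp]:
  "fst (pair_of_vec2 v) = vec_nth v 1" "snd (pair_of_vec2 v) = vec_nth v 2"
  by (simp_all add: pair_of_vec2_def)

lemma complex_of_vec2_simps [simp]:
  "Re (complex_of_vec2 v) = vec_nth v 1" "Im (complex_of_vec2 v) = vec_nth v 2"
  by (simp_all add: complex_of_vec2_def)

lemma vec2_complex_inverse [simp]:
  "vec2_of_complex (complex_of_vec2 v) = v" "complex_of_vec2 (vec2_of_complex z) = z"
  by (simp_all add: vec_eq_iff forall_2 complex_eq_iff)

lemma vec2_pair_inverse [simp]:
  "vec2_of_pair (pair_of_vec2 v) = v" "pair_of_vec2 (vec2_of_pair p) = p"
  by (simp_all add: vec_eq_iff forall_2 pair_of_vec2_def prod_eq_iff)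

lemma bounded_linear_vec2 [simp]:
  "bounded_linear vec2_of_complex" "bounded_linear complex_of_vec2"
  "bounded_linear vec2_of_pair" "bounded_linear pair_of_vec2"
  by (auto intro!: linear_conv_bounded_linear[THEN iffD1] linearI
      simp: vec_eq_iff forall_2 complex_eq_iff prod_eq_iff pair_of_vec2_def)

lemma cbox_vec2: "x \<in> cbox u v \<longleftrightarrow> vec_nth u 1 \<le> vec_nth x 1 \<and> vec_nth x 1 \<le> vec_nth v 1 \<and> vec_nth u 2 \<le> vec_nth x 2 \<and> vec_nth x 2 \<le> vec_nth v 2"
  for x :: "real^2"
  by (auto simp: mem_box_cart forall_2)

lemma cbox_complex:
  "z \<in> cbox u v \<longleftrightarrow> Re u \<le> Re z \<and> Re z \<le> Re v \<and> Im u \<le> Im z \<and> Im z \<le> Im v"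
  by (auto simp: mem_box Basis_complex_def)

lemma cbox_pair:
  "x \<in> cbox p q \<longleftrightarrow> fst p \<le> fst x \<and> fst x \<le> fst q \<and> snd p \<le> snd x \<and> snd x \<le> snd q"
  for p :: "real \<times> real"
  by (cases p; cases q; cases x) auto

lemma image_cbox_vec2:
  "vec2_of_complex ` cbox u v = cbox (vec2_of_complex u) (vec2_of_complex v)"
  "complex_of_vec2 ` cbox a b = cbox (complex_of_vec2 a) (complex_of_vec2 b)"
  "vec2_of_pair ` cbox p q = cbox (vec2_of_pair p) (vec2_of_pair q)"
  "pair_of_vec2 ` cbox a b = cbox (pair_of_vec2 a) (pair_of_vec2 b)"
proof -
  show "vec2_of_complex ` cbox u v = cbox (vec2_of_complex u) (vec2_of_complex v)"
  proof (intro set_eqI iffI)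
    fix x assume "x \<in> cbox (vec2_of_complex u) (vec2_of_complex v)"
    then show "x \<in> vec2_of_complex ` cbox u v"
      by (intro image_eqI[of _ _ "complex_of_vec2 x"]) (auto simp: cbox_vec2 cbox_complex)
  qed (auto simp: cbox_vec2 cbox_complex)
  show "complex_of_vec2 ` cbox a b = cbox (complex_of_vec2 a) (complex_of_vec2 b)"
  proof (intro set_eqI iffI)
    fix x assume "x \<in> cbox (complex_of_vec2 a) (complex_of_vec2 b)"
    then show "x \<in> complex_of_vec2 ` cbox a b"
      by (intro image_eqI[of _ _ "vec2_of_complex x"]) (auto simp: cbox_vec2 cbox_complex)
  qed (auto simp: cbox_vec2 cbox_complex)
  show "vec2_of_pair ` cbox p q = cbox (vec2_of_pair p) (vec2_of_pair q)"
  proof (intro set_eqI iffI)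
    fix x assume "x \<in> cbox (vec2_of_pair p) (vec2_of_pair q)"
    then show "x \<in> vec2_of_pair ` cbox p q"
      by (intro image_eqI[of _ _ "pair_of_vec2 x"]) (auto simp: cbox_vec2 cbox_pair)
  qed (auto simp: cbox_vec2 cbox_pair)
  show "pair_of_vec2 ` cbox a b = cbox (pair_of_vec2 a) (pair_of_vec2 b)"
  proof (intro set_eqI iffI)
    fix x assume "x \<in> cbox (pair_of_vec2 a) (pair_of_vec2 b)"
    then show "x \<in> pair_of_vec2 ` cbox a b"
      by (intro image_eqI[of _ _ "vec2_of_pair x"]) (auto simp: cbox_vec2 cbox_pair)
  qed (auto simp: cbox_vec2 cbox_pair)
qed

lemma ex_2_iff: "(\<exists>i::2. P i) \<longleftrightarrow> P 1 \<or> P 2"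
  using forall_2[of "\<lambda>i. \<not> P i"] by blast

lemma content_vec2:
  "measure lborel (cbox a b) = (if vec_nth a 1 \<le> vec_nth b 1 \<and> vec_nth a 2 \<le> vec_nth b 2 then (vec_nth b 1 - vec_nth a 1) * (vec_nth b 2 - vec_nth a 2) else 0)"
  for a b :: "real^2"
proof -
  have "cbox a b = {} \<longleftrightarrow> \<not> (vec_nth a 1 \<le> vec_nth b 1 \<and> vec_nth a 2 \<le> vec_nth b 2)"
    by (auto simp: interval_eq_empty_cart(2) ex_2_iff not_le)
  then show ?thesis
    by (simp add: content_cbox_if_cart UNIV_2)
qed

lemma content_complex_of_vec2: "measure lborel (complex_of_vec2 ` cbox a b) = measure lborel (cbox a b)"
proof -
  have "measure lborel (cbox u v) =
      (if Re u \<le> Re v \<and> Im u \<le> Im v then (Re v - Re u) * (Im v - Im u) else 0)" for u v :: complex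
  proof (cases "Re u \<le> Re v \<and> Im u \<le> Im v")
    case True
    then have "measure lborel (cbox u v) = (\<Prod>i\<in>Basis. v \<bullet> i - u \<bullet> i)"
      by (intro content_cbox) (auto simp: Basis_complex_def)
    also have "\<dots> = (Re v - Re u) * (Im v - Im u)"
      by (simp add: Basis_complex_def)
    finally show ?thesis using True by simp
  next
    case False
    then have "cbox u v = {}"
      unfolding box_eq_empty Basis_complex_def by force
    then show ?thesis using False by auto
  qed
  then show ?thesis
    by (simp add: image_cbox_vec2 content_vec2)
qed

lemma content_vec2_of_pair: "measure lborel (vec2_of_pair ` cbox p q) = measure lborel (cbox p q)"
  by (cases p; cases q) (auto simp: image_cbox_vec2 content_vec2 content_Pair)

lemma has_integral_complex_of_vec2:
  fixes f :: "complex \<Rightarrow> 'c::banach"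
  assumes "((\<lambda>v. f (complex_of_vec2 v)) has_integral i) S" and "bounded S"
  shows "(f has_integral i) (complex_of_vec2 ` S)"
proof -
  have "measure lborel (vec2_of_complex ` cbox u v) = measure lborel (cbox u v)" for u v
    using content_complex_of_vec2[of "vec2_of_complex u" "vec2_of_complex v"]
    by (simp add: image_cbox_vec2)
  moreover have "\<exists>w z. vec2_of_complex ` cbox u v = cbox w z" "\<exists>w z. complex_of_vec2 ` cbox a b = cbox w z" for u v a b
    by (simp_all only: image_cbox_vec2) blast+
  ultimately have "((\<lambda>x. f (complex_of_vec2 (vec2_of_complex x))) has_integral i) (complex_of_vec2 ` S)"
    using assms
    by (intro has_integral_measure_preserving[where g = vec2_of_complex and h = complex_of_vec2])
      (simp_all add: linear_continuous_at)
  then show ?thesis by simp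
qed

lemma integral_vec2_of_pair:
  fixes f :: "real^2 \<Rightarrow> 'c::banach"
  assumes "continuous_on (cbox (vec2_of_pair p) (vec2_of_pair q)) f"
  shows "integral (cbox (vec2_of_pair p) (vec2_of_pair q)) f = integral (cbox p q) (\<lambda>x. f (vec2_of_pair x))"
proof -
  have "(f has_integral integral (cbox (vec2_of_pair p) (vec2_of_pair q)) f)
          (cbox (vec2_of_pair p) (vec2_of_pair q))"
    using assms integrable_continuous by blast
  moreover have "\<exists>w z. vec2_of_pair ` cbox u v = cbox w z" "\<exists>w z. pair_of_vec2 ` cbox a b = cbox w z" for u v a b
    by (simp_all only: image_cbox_vec2) blast+
  ultimately have "((\<lambda>x. f (vec2_of_pair x)) has_integral integral (cbox (vec2_of_pair p) (vec2_of_pair q)) f)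
      (pair_of_vec2 ` cbox (vec2_of_pair p) (vec2_of_pair q))"
    by (intro has_integral_measure_preserving[where g = vec2_of_pair and h = pair_of_vec2])
      (simp_all add: linear_continuous_at content_vec2_of_pair)
  then show ?thesis
    by (simp add: image_cbox_vec2 integral_unique)
qed

text \<open>For \<open>a, b :: complex\<close>, \<open>Im (cnj a * b)\<close> is the determinant of the pair \<open>(a, b)\<close>.\<close>

lemma has_integral_change_of_variables_complex:
  fixes \<Phi> :: "real \<times> real \<Rightarrow> complex" and f :: "complex \<Rightarrow> complex"
  assumes deriv: "\<And>x. x \<in> cbox p q \<Longrightarrow>
      (\<Phi> has_derivative (\<lambda>h. of_real (fst h) * A x + of_real (snd h) * B x)) (at x within cbox p q)"
    and inj: "inj_on \<Phi> (cbox p q)"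
    and A: "continuous_on (cbox p q) A" and B: "continuous_on (cbox p q) B"
    and f: "continuous_on (\<Phi> ` cbox p q) f"
  shows "(f has_integral integral (cbox p q) (\<lambda>x. \<bar>Im (cnj (A x) * B x)\<bar> *\<^sub>R f (\<Phi> x))) (\<Phi> ` cbox p q)"
proof -
  let ?R = "cbox (vec2_of_pair p) (vec2_of_pair q)"
  \<comment> \<open>The coordinate isomorphisms turn \<open>\<Phi>\<close> and \<open>f\<close> into
    a map and an integrand on \<open>real^2\<close>; the values of \<open>F\<close> are vectors as
    well and are translated back at the end.\<close>
  define \<Psi> where "\<Psi> v = vec2_of_complex (\<Phi> (pair_of_vec2 v))" for v
  define \<Psi>' where "\<Psi>' v h = vec2_of_complex (of_real (vec_nth h 1) * A (pair_of_vec2 v) + of_real (vec_nth h 2) * B (pair_of_vec2 v))"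
    for v h :: "real^2"
  define F where "F v = vec2_of_complex (f (complex_of_vec2 v))" for v
  define J where "J x = \<bar>Im (cnj (A x) * B x)\<bar>" for x
  have R: "pair_of_vec2 ` ?R = cbox p q"
    by (simp add: image_cbox_vec2)
  have memR: "pair_of_vec2 v \<in> cbox p q" if "v \<in> ?R" for v
    using R that by blast
  have cont_pair: "continuous_on T pair_of_vec2" for T
    by (simp add: linear_continuous_on)
  have cont_\<Phi>: "continuous_on (cbox p q) \<Phi>"
    using deriv by (meson continuous_on_eq_continuous_within has_derivative_continuous)
  have cont_J: "continuous_on (cbox p q) (\<lambda>x. J x *\<^sub>R f (\<Phi> x))"
    unfolding J_def using A B cont_\<Phi> f
    by (intro continuous_intros continuous_on_compose2[OF f cont_\<Phi>]) auto
  have der: "(\<Psi> has_derivative \<Psi>' v) (at v within ?R)" if "v \<in> ?R" for v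
  proof -
    have "((\<lambda>v. \<Phi> (pair_of_vec2 v)) has_derivative
        (\<lambda>h. of_real (fst (pair_of_vec2 h)) * A (pair_of_vec2 v) + of_real (snd (pair_of_vec2 h)) * B (pair_of_vec2 v)))
        (at v within ?R)"
      using deriv[OF memR[OF that]] R
      by (intro has_derivative_in_compose[where f = pair_of_vec2 and g = \<Phi>]
          bounded_linear_imp_has_derivative) auto
    then show ?thesis
      unfolding \<Psi>_def \<Psi>'_def
      by (auto dest: bounded_linear.has_derivative[OF bounded_linear_vec2(1)] simp: pair_of_vec2_def)
  qed
  have det: "\<bar>det (matrix (\<Psi>' v))\<bar> = J (pair_of_vec2 v)" for v
    by (simp add: det_2 matrix_def \<Psi>'_def J_def axis_def abs_minus_commute mult.commute)
  have inj_\<Psi>: "inj_on \<Psi> ?R"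
  proof (rule inj_onI)
    fix u v assume "u \<in> ?R" "v \<in> ?R" "\<Psi> u = \<Psi> v"
    then have "\<Phi> (pair_of_vec2 u) = \<Phi> (pair_of_vec2 v)"
      unfolding \<Psi>_def by (metis vec2_complex_inverse(2))
    then have "pair_of_vec2 u = pair_of_vec2 v"
      using inj_onD[OF inj] memR \<open>u \<in> ?R\<close> \<open>v \<in> ?R\<close> by blast
    then show "u = v" by (metis vec2_pair_inverse(1))
  qed
  have cont: "continuous_on ?R (\<lambda>v. J (pair_of_vec2 v) *\<^sub>R F (\<Psi> v))"
  proof -
    have "continuous_on ?R (\<lambda>v. vec2_of_complex (J (pair_of_vec2 v) *\<^sub>R f (\<Phi> (pair_of_vec2 v))))"
      by (intro bounded_linear.continuous_on[OF bounded_linear_vec2(1)]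
          continuous_on_compose2[OF cont_J cont_pair]) (auto simp: memR)
    then show ?thesis
      by (simp add: F_def \<Psi>_def bounded_linear.linear linear_cmul)
  qed
  define b where "b = integral ?R (\<lambda>v. J (pair_of_vec2 v) *\<^sub>R F (\<Psi> v))"
  have "(\<lambda>v. J (pair_of_vec2 v) *\<^sub>R F (\<Psi> v)) absolutely_integrable_on ?R"
    using cont absolutely_integrable_continuous by blast
  then have "F absolutely_integrable_on \<Psi> ` ?R \<and> integral (\<Psi> ` ?R) F = b"
    using has_absolute_integral_change_of_variables[OF _ der inj_\<Psi>, of F b]
    by (simp add: det b_def)
  then have "(F has_integral b) (\<Psi> ` ?R)"
    using absolutely_integrable_on_def by blast
  then have "((\<lambda>v. complex_of_vec2 (F v)) has_integral complex_of_vec2 b) (\<Psi> ` ?R)"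
    using has_integral_linear[OF _ bounded_linear_vec2(2)] by (auto simp: o_def)
  moreover have "bounded (\<Psi> ` ?R)"
    using der by (intro compact_imp_bounded compact_continuous_image)
      (auto simp: continuous_on_eq_continuous_within intro: has_derivative_continuous)
  ultimately have "(f has_integral complex_of_vec2 b) (complex_of_vec2 ` \<Psi> ` ?R)"
    by (intro has_integral_complex_of_vec2) (auto simp: F_def)
  moreover have "complex_of_vec2 ` \<Psi> ` ?R = \<Phi> ` cbox p q"
    by (simp add: \<Psi>_def image_image flip: R)
  moreover have "complex_of_vec2 b = integral (cbox p q) (\<lambda>x. J x *\<^sub>R f (\<Phi> x))"
  proof -
    have "b = integral (cbox p q) (\<lambda>x. J x *\<^sub>R vec2_of_complex (f (\<Phi> x)))"
      unfolding b_def using integral_vec2_of_pair[OF cont] by (simp add: \<Psi>_def F_def)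
    also have "\<dots> = integral (cbox p q) (vec2_of_complex \<circ> (\<lambda>x. J x *\<^sub>R f (\<Phi> x)))"
      by (simp add: o_def bounded_linear.linear linear_cmul)
    also have "\<dots> = vec2_of_complex (integral (cbox p q) (\<lambda>x. J x *\<^sub>R f (\<Phi> x)))"
      by (intro integral_linear integrable_continuous cont_J bounded_linear_vec2)
    finally show ?thesis by simp
  qed
  ultimately show ?thesis by (simp add: J_def)
qed

section \<open>Functions with continuous gradient off a set\<close>

text \<open>The exceptional set is a parameter so that bump functions (\<open>A = {}\<close>) and
  the distance to a point fit one notion. Continuity of \<open>g\<close> is kept across
  \<open>A\<close> because boundary curves may pass through \<open>A\<close>.\<close>

definition C1_off :: "complex set \<Rightarrow> (complex \<Rightarrow> real) \<Rightarrow> (complex \<Rightarrow> complex) \<Rightarrow> bool" where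
  "C1_off A g G \<longleftrightarrow> continuous_on UNIV g \<and> continuous_on (-A) G \<and>
     (\<forall>x\<in>-A. (g has_derivative (\<lambda>h. G x \<bullet> h)) (at x))"

section \<open>Normal coordinates along a curve and Green's formula on a curved box\<close>

text \<open>\<open>Im (cnj z * n)\<close> is the coordinate of \<open>z\<close> transverse to
  \<open>n\<close>; along the curve its derivative is the Jacobian determinant, positive by
  \<open>pos\<close>.\<close>

lemma strict_mono_on_normal_coordinate:
  fixes \<gamma> D :: "real \<Rightarrow> complex"
  assumes \<gamma>: "\<And>t. t \<in> {t1..t2} \<Longrightarrow> (\<gamma> has_vector_derivative D t) (at t within {t1..t2})"
    and pos: "\<And>t. t \<in> {t1..t2} \<Longrightarrow> Im (cnj (D t) * n) > 0"
  shows "strict_mono_on {t1..t2} (\<lambda>t. Im (cnj (\<gamma> t) * n))"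
proof (rule strict_mono_onI)
  fix a b assume ab: "a \<in> {t1..t2}" "b \<in> {t1..t2}" "a < b"
  have der: "((\<lambda>t. Im (cnj (\<gamma> t) * n)) has_vector_derivative Im (cnj (D t) * n)) (at t within {a..b})"
    if "t \<in> {a..b}" for t
  proof -
    have "(\<gamma> has_vector_derivative D t) (at t within {a..b})"
      using \<gamma>[of t] that ab has_vector_derivative_within_subset by fastforce
    moreover have "bounded_linear (\<lambda>z. Im (cnj z * n))"
      by (intro linear_conv_bounded_linear[THEN iffD1] linearI) (simp_all add: algebra_simps)
    ultimately show ?thesis
      by (rule bounded_linear.has_vector_derivative[rotated])
  qed
  show "Im (cnj (\<gamma> a) * n) < Im (cnj (\<gamma> b) * n)"
  proof (rule DERIV_pos_imp_increasing_open[OF \<open>a < b\<close>])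
    fix t assume t: "a < t" "t < b"
    then have "((\<lambda>t. Im (cnj (\<gamma> t) * n)) has_vector_derivative Im (cnj (D t) * n)) (at t)"
      using der[of t] at_within_Icc_at[of a t b] by simp
    then show "\<exists>y. ((\<lambda>t. Im (cnj (\<gamma> t) * n)) has_real_derivative y) (at t) \<and> 0 < y"
      using pos[of t] t ab by (auto simp: has_real_derivative_iff_has_vector_derivative)
  next
    show "continuous_on {a..b} (\<lambda>t. Im (cnj (\<gamma> t) * n))"
      using der has_vector_derivative_continuous continuous_on_eq_continuous_within by blast
  qed
qed

text \<open>Adding a multiple of \<open>n\<close> leaves the transverse coordinate unchanged, so
  that coordinate determines \<open>t\<close> by strict monotonicity; then
  \<open>n \<noteq> 0\<close> determines \<open>s\<close>.\<close>

lemma inj_on_normal_translates: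
  fixes \<gamma> D :: "real \<Rightarrow> complex"
  assumes \<gamma>: "\<And>t. t \<in> {t1..t2} \<Longrightarrow> (\<gamma> has_vector_derivative D t) (at t within {t1..t2})"
    and pos: "\<And>t. t \<in> {t1..t2} \<Longrightarrow> Im (cnj (D t) * n) > 0"
  shows "inj_on (\<lambda>p. \<gamma> (fst p) + of_real (snd p) * n) ({t1..t2} \<times> UNIV)"
proof (rule inj_onI)
  fix p q :: "real \<times> real"
  assume p: "p \<in> {t1..t2} \<times> UNIV" and q: "q \<in> {t1..t2} \<times> UNIV"
    and eq: "\<gamma> (fst p) + of_real (snd p) * n = \<gamma> (fst q) + of_real (snd q) * n"
  have "Im (cnj (\<gamma> t + of_real s * n) * n) = Im (cnj (\<gamma> t) * n)" for t s
    by (simp add: algebra_simps)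
  then have "Im (cnj (\<gamma> (fst p)) * n) = Im (cnj (\<gamma> (fst q)) * n)"
    using eq by metis
  moreover have "inj_on (\<lambda>t. Im (cnj (\<gamma> t) * n)) {t1..t2}"
    by (intro strict_mono_on_imp_inj_on strict_mono_on_normal_coordinate[OF \<gamma> pos]) auto
  ultimately have "fst p = fst q"
    using p q by (auto dest: inj_onD)
  moreover have "n \<noteq> 0"
    using pos[of "fst p"] p by auto
  ultimately show "p = q"
    using eq by (simp add: prod_eq_iff)
qed

text \<open>Up to the determinant of \<open>a\<close> and \<open>b\<close>, the vectors
  \<open>- \<i> * b\<close> and \<open>\<i> * a\<close> form the dual basis. With a gradient for
  \<open>w\<close>, the coefficients are its derivatives in the directions \<open>a\<close> and
  \<open>b\<close>.\<close>

lemma dual_basis_complex: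
  "Im (cnj a * b) *\<^sub>R w = (w \<bullet> a) *\<^sub>R (- \<i> * b) + (w \<bullet> b) *\<^sub>R (\<i> * a)" for a b w :: complex
  by (simp add: complex_eq_iff inner_complex_def algebra_simps)

lemma has_vector_derivative_C1_off_compose:
  assumes g: "C1_off {} g G" and \<gamma>: "(\<gamma> has_vector_derivative v) (at t within S)"
  shows "((\<lambda>t. g (\<gamma> t)) has_vector_derivative (G (\<gamma> t) \<bullet> v)) (at t within S)"
proof -
  have "(g has_derivative (\<lambda>h. G (\<gamma> t) \<bullet> h)) (at (\<gamma> t) within \<gamma> ` S)"
    using g unfolding C1_off_def by (auto intro: has_derivative_at_withinI)
  from has_derivative_in_compose[OF \<gamma>[unfolded has_vector_derivative_def] this]
  show ?thesis
    by (simp add: has_vector_derivative_def)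
qed

text \<open>In the coordinates \<open>(t, s) \<mapsto> \<gamma> t + s n\<close> the gradient times the Jacobian is a combination of
  \<open>\<partial>\<^sub>t\<close> with a constant coefficient and \<open>\<partial>\<^sub>s\<close> with a coefficient depending only on \<open>t\<close>
  (\<open>dual_basis_complex\<close>), so each term integrates exactly in one variable.  No second derivative of
  \<open>\<gamma>\<close> is needed.\<close>

lemma Green_curved_box:
  fixes \<gamma> D :: "real \<Rightarrow> complex"
  assumes t12: "t1 < t2" and \<sigma>: "0 < \<sigma>"
    and \<gamma>: "\<And>t. t \<in> {t1..t2} \<Longrightarrow> (\<gamma> has_vector_derivative D t) (at t within {t1..t2})"
    and contD: "continuous_on {t1..t2} D"
    and pos: "\<And>t. t \<in> {t1..t2} \<Longrightarrow> Im (cnj (D t) * n) > 0"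
    and g: "C1_off {} g G"
    and sides: "\<And>s. s \<in> {0..\<sigma>} \<Longrightarrow> g (\<gamma> t1 + of_real s * n) = 0 \<and> g (\<gamma> t2 + of_real s * n) = 0"
    and top: "\<And>t. t \<in> {t1..t2} \<Longrightarrow> g (\<gamma> t + of_real \<sigma> * n) = 0"
  shows "(G has_integral (- \<i> * integral {t1..t2} (\<lambda>t. of_real (g (\<gamma> t)) * D t)))
           ((\<lambda>p. \<gamma> (fst p) + of_real (snd p) * n) ` ({t1..t2} \<times> {0..\<sigma>}))"
proof -
  define \<Phi> where "\<Phi> p = \<gamma> (fst p) + of_real (snd p) * n" for p
  let ?R = "cbox (t1, 0) (t2, \<sigma>)"
  have R: "?R = {t1..t2} \<times> {0..\<sigma>}"
    by (simp add: cbox_Pair_eq)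
  have contG: "continuous_on S G" for S
    using g unfolding C1_off_def by (auto intro: continuous_on_subset)
  have cont\<gamma>: "continuous_on {t1..t2} \<gamma>"
    using \<gamma> has_vector_derivative_continuous continuous_on_eq_continuous_within by blast
  have cont\<gamma>f: "continuous_on ?R (\<lambda>p. \<gamma> (fst p))" and contDf: "continuous_on ?R (\<lambda>p. D (fst p))"
    by (intro continuous_on_compose2[OF cont\<gamma>] continuous_on_compose2[OF contD] continuous_intros;
        auto simp: R)+
  have cont\<Phi>: "continuous_on ?R \<Phi>"
    unfolding \<Phi>_def by (intro continuous_intros cont\<gamma>f)
  have contG\<Phi>: "continuous_on ?R (\<lambda>p. G (\<Phi> p))"
    by (intro continuous_on_compose2[OF contG cont\<Phi>]) auto
  have der: "(\<Phi> has_derivative (\<lambda>h. of_real (fst h) * D (fst x) + of_real (snd h) * n)) (at x within ?R)"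
    if "x \<in> ?R" for x
  proof -
    have x: "fst x \<in> {t1..t2}" and im: "fst ` ?R \<subseteq> {t1..t2}"
      using that R by auto
    have "(\<gamma> has_derivative (\<lambda>h. h *\<^sub>R D (fst x))) (at (fst x) within fst ` ?R)"
      using has_derivative_subset[OF \<gamma>[OF x, unfolded has_vector_derivative_def] im] .
    then have "((\<lambda>p. \<gamma> (fst p)) has_derivative (\<lambda>h. fst h *\<^sub>R D (fst x))) (at x within ?R)"
      by (intro has_derivative_in_compose[where f = fst and g = \<gamma>] derivative_intros)
    then show ?thesis
      unfolding \<Phi>_def by (auto intro!: derivative_eq_intros simp: scaleR_conv_of_real)
  qed
  have inj: "inj_on \<Phi> ?R"
    unfolding \<Phi>_def R by (rule inj_on_subset[OF inj_on_normal_translates[OF \<gamma> pos]]) auto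
  have "(G has_integral integral ?R (\<lambda>p. \<bar>Im (cnj (D (fst p)) * n)\<bar> *\<^sub>R G (\<Phi> p))) (\<Phi> ` ?R)"
    by (intro has_integral_change_of_variables_complex der inj contDf contG continuous_intros)
  also have "integral ?R (\<lambda>p. \<bar>Im (cnj (D (fst p)) * n)\<bar> *\<^sub>R G (\<Phi> p)) =
      integral ?R (\<lambda>p. (G (\<Phi> p) \<bullet> D (fst p)) *\<^sub>R (- \<i> * n) + (G (\<Phi> p) \<bullet> n) *\<^sub>R (\<i> * D (fst p)))"
  proof (rule integral_cong)
    fix p assume "p \<in> ?R"
    then have "\<bar>Im (cnj (D (fst p)) * n)\<bar> = Im (cnj (D (fst p)) * n)"
      using pos[of "fst p"] R by auto
    then show "\<bar>Im (cnj (D (fst p)) * n)\<bar> *\<^sub>R G (\<Phi> p) =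
        (G (\<Phi> p) \<bullet> D (fst p)) *\<^sub>R (- \<i> * n) + (G (\<Phi> p) \<bullet> n) *\<^sub>R (\<i> * D (fst p))"
      by (simp only: dual_basis_complex)
  qed
  also have "\<dots> = integral ?R (\<lambda>p. (G (\<Phi> p) \<bullet> D (fst p)) *\<^sub>R (- \<i> * n)) +
      integral ?R (\<lambda>p. (G (\<Phi> p) \<bullet> n) *\<^sub>R (\<i> * D (fst p)))"
    by (intro integral_add integrable_continuous continuous_intros contG\<Phi> contDf)
  also have "integral ?R (\<lambda>p. (G (\<Phi> p) \<bullet> D (fst p)) *\<^sub>R (- \<i> * n)) = 0"
  proof -
    have c: "continuous_on ?R (\<lambda>p. (G (\<Phi> p) \<bullet> D (fst p)) *\<^sub>R (- \<i> * n))"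
      by (intro continuous_intros contG\<Phi> contDf)
    have "integral ?R (\<lambda>p. (G (\<Phi> p) \<bullet> D (fst p)) *\<^sub>R (- \<i> * n)) =
        integral (cbox t1 t2) (\<lambda>t. integral (cbox 0 \<sigma>) (\<lambda>s. (G (\<Phi> (t, s)) \<bullet> D t) *\<^sub>R (- \<i> * n)))"
      using integral_prod_continuous[OF c] by simp
    \<comment> \<open>After the exchange \<open>t\<close> is integrated first:
      \<open>- \<i> * n\<close> is constant, the other factor is the \<open>t\<close>-derivative of
      \<open>g (\<Phi> (t, s))\<close>, and \<open>sides\<close> makes both endpoint values
      vanish.\<close>
    also have "\<dots> = integral (cbox 0 \<sigma>) (\<lambda>s. integral (cbox t1 t2) (\<lambda>t. (G (\<Phi> (t, s)) \<bullet> D t) *\<^sub>R (- \<i> * n)))"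
      by (rule integral_swap_continuous) (use c in \<open>simp add: case_prod_unfold\<close>)
    also have "\<dots> = integral (cbox 0 \<sigma>) (\<lambda>s. 0)"
    proof (rule integral_cong)
      fix s assume s: "s \<in> cbox 0 \<sigma>"
      have "((\<lambda>t. G (\<Phi> (t, s)) \<bullet> D t) has_integral (g (\<Phi> (t2, s)) - g (\<Phi> (t1, s)))) {t1..t2}"
      proof (rule fundamental_theorem_of_calculus)
        fix t assume "t \<in> {t1..t2}"
        then have "((\<lambda>t. \<Phi> (t, s)) has_vector_derivative D t) (at t within {t1..t2})"
          unfolding \<Phi>_def using \<gamma> by (auto intro!: derivative_eq_intros)
        from has_vector_derivative_C1_off_compose[OF g this]
        show "((\<lambda>t. g (\<Phi> (t, s))) has_vector_derivative (G (\<Phi> (t, s)) \<bullet> D t)) (at t within {t1..t2})" .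
      qed (use t12 in auto)
      moreover have "g (\<Phi> (t2, s)) - g (\<Phi> (t1, s)) = 0"
        using sides s by (auto simp: \<Phi>_def)
      ultimately have "((\<lambda>t. (G (\<Phi> (t, s)) \<bullet> D t) *\<^sub>R (- \<i> * n)) has_integral 0 *\<^sub>R (- \<i> * n)) {t1..t2}"
        using has_integral_scaleR_left[of "\<lambda>t. G (\<Phi> (t, s)) \<bullet> D t" 0 "{t1..t2}" "- \<i> * n"] by simp
      then show "integral (cbox t1 t2) (\<lambda>t. (G (\<Phi> (t, s)) \<bullet> D t) *\<^sub>R (- \<i> * n)) = 0"
        by (simp only: scaleR_zero_left cbox_interval integral_unique)
    qed
    finally show ?thesis by simp
  qed
  also have "integral ?R (\<lambda>p. (G (\<Phi> p) \<bullet> n) *\<^sub>R (\<i> * D (fst p))) =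
      - \<i> * integral {t1..t2} (\<lambda>t. of_real (g (\<gamma> t)) * D t)"
  proof -
    have c: "continuous_on ?R (\<lambda>p. (G (\<Phi> p) \<bullet> n) *\<^sub>R (\<i> * D (fst p)))"
      by (intro continuous_intros contG\<Phi> contDf)
    have "integral ?R (\<lambda>p. (G (\<Phi> p) \<bullet> n) *\<^sub>R (\<i> * D (fst p))) =
        integral (cbox t1 t2) (\<lambda>t. integral (cbox 0 \<sigma>) (\<lambda>s. (G (\<Phi> (t, s)) \<bullet> n) *\<^sub>R (\<i> * D t)))"
      using integral_prod_continuous[OF c] by simp
    also have "\<dots> = integral {t1..t2} (\<lambda>t. - \<i> * (of_real (g (\<gamma> t)) * D t))"
      unfolding cbox_interval
    proof (rule integral_cong)
      fix t assume t: "t \<in> {t1..t2}"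
      \<comment> \<open>Here \<open>s\<close> is the inner variable and \<open>D t\<close> a
        constant factor. By \<open>top\<close> only the lower endpoint contributes, which lies on
        the curve and carries a minus sign.\<close>
      have "((\<lambda>s. G (\<Phi> (t, s)) \<bullet> n) has_integral (g (\<Phi> (t, \<sigma>)) - g (\<Phi> (t, 0)))) {0..\<sigma>}"
      proof (rule fundamental_theorem_of_calculus)
        fix s assume "s \<in> {0..\<sigma>}"
        have "((\<lambda>s. \<Phi> (t, s)) has_vector_derivative n) (at s within {0..\<sigma>})"
          unfolding \<Phi>_def has_vector_derivative_def
          by (auto intro!: derivative_eq_intros simp: scaleR_conv_of_real)
        from has_vector_derivative_C1_off_compose[OF g this]
        show "((\<lambda>s. g (\<Phi> (t, s))) has_vector_derivative (G (\<Phi> (t, s)) \<bullet> n)) (at s within {0..\<sigma>})" .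
      qed (use \<sigma> in auto)
      moreover have "g (\<Phi> (t, \<sigma>)) - g (\<Phi> (t, 0)) = - g (\<gamma> t)"
        using top t by (auto simp: \<Phi>_def)
      ultimately have "((\<lambda>s. (G (\<Phi> (t, s)) \<bullet> n) *\<^sub>R (\<i> * D t)) has_integral (- g (\<gamma> t)) *\<^sub>R (\<i> * D t)) {0..\<sigma>}"
        by (intro has_integral_scaleR_left) simp
      then show "integral {0..\<sigma>} (\<lambda>s. (G (\<Phi> (t, s)) \<bullet> n) *\<^sub>R (\<i> * D t)) = - \<i> * (of_real (g (\<gamma> t)) * D t)"
        by (subst integral_unique) (auto simp: scaleR_conv_of_real mult_ac)
    qed
    also have "\<dots> = - \<i> * integral {t1..t2} (\<lambda>t. of_real (g (\<gamma> t)) * D t)"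
      by (rule integral_mult_right)
    finally show ?thesis .
  qed
  finally show ?thesis
    by (simp add: \<Phi>_def[abs_def] R)
qed

lemma C1_off_mono: "C1_off A g G \<Longrightarrow> A \<subseteq> B \<Longrightarrow> C1_off B g G"
  unfolding C1_off_def by (auto intro: continuous_on_subset)

lemma C1_off_continuous: "C1_off A g G \<Longrightarrow> continuous_on S g"
  unfolding C1_off_def by (auto intro: continuous_on_subset)

lemma C1_off_const: "C1_off A (\<lambda>_. c) (\<lambda>_. 0)"
  unfolding C1_off_def by (auto intro!: derivative_eq_intros)

lemma C1_off_diff:
  assumes "C1_off A f F" "C1_off A g G"
  shows "C1_off A (\<lambda>x. f x - g x) (\<lambda>x. F x - G x)"
  using assms unfolding C1_off_def
  by (auto intro!: continuous_intros derivative_eq_intros simp: inner_diff_left)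

lemma C1_off_mult:
  assumes "C1_off A f F" "C1_off A g G"
  shows "C1_off A (\<lambda>x. f x * g x) (\<lambda>x. f x *\<^sub>R G x + g x *\<^sub>R F x)"
proof -
  have "continuous_on (-A) f" "continuous_on (-A) g"
    using assms by (auto intro: C1_off_continuous)
  then show ?thesis
    using assms unfolding C1_off_def
    by (auto intro!: continuous_intros derivative_eq_intros simp: inner_add_left)
qed

text \<open>By uniqueness of the derivative. It lets area integrals of \<open>G\<close> be
  restricted to the support of \<open>g\<close>.\<close>

lemma C1_off_gradient_eq_0:
  assumes g: "C1_off A g G" and "open S" "x \<in> S" "x \<notin> A" and 0: "\<And>y. y \<in> S \<Longrightarrow> g y = 0"
  shows "G x = 0"
proof -
  have "(g has_derivative (\<lambda>h. G x \<bullet> h)) (at x)"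
    using assms unfolding C1_off_def by auto
  then have "((\<lambda>_. 0) has_derivative (\<lambda>h. G x \<bullet> h)) (at x)"
    by (rule has_derivative_transform_within_open) (use assms in auto)
  then have "(\<lambda>h. G x \<bullet> h) = (\<lambda>_. 0)"
    using has_derivative_unique has_derivative_const by blast
  then show ?thesis
    by (metis inner_eq_zero_iff)
qed

section \<open>A C^1 bump function\<close>

text \<open>Squaring removes the kink of the positive part: at 0 the difference quotient is
  \<open>max 0 h\<close>, which tends to 0.\<close>

lemma DERIV_max_0_squared: "((\<lambda>s. (max 0 s)\<^sup>2) has_real_derivative 2 * max 0 s) (at s)"
proof -
  consider "s < 0" | "s > 0" | "s = 0" by linarith
  then show ?thesis
  proof cases
    case 1
    have "((\<lambda>s::real. 0) has_real_derivative 0) (at s)" by simp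
    then have "((\<lambda>s. (max 0 s)\<^sup>2) has_real_derivative 0) (at s)"
      by (rule has_field_derivative_transform_within_open[of _ _ _ "{..<0}"]) (use 1 in auto)
    then show ?thesis using 1 by simp
  next
    case 2
    have "((\<lambda>s::real. s\<^sup>2) has_real_derivative 2 * s) (at s)"
      by (auto intro!: derivative_eq_intros)
    then have "((\<lambda>s. (max 0 s)\<^sup>2) has_real_derivative 2 * s) (at s)"
      by (rule has_field_derivative_transform_within_open[of _ _ _ "{0<..}"]) (use 2 in auto)
    then show ?thesis using 2 by simp
  next
    case 3
    have "((\<lambda>h. max 0 h) \<longlongrightarrow> max 0 0) (at (0::real))"
      by (intro tendsto_intros)
    moreover have "\<forall>\<^sub>F h in at (0::real). max 0 h = (max 0 h)\<^sup>2 / h"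
      by (auto simp: eventually_at_filter power2_eq_square max_def)
    ultimately have "((\<lambda>h. (max 0 h)\<^sup>2 / h) \<longlongrightarrow> 0) (at (0::real))"
      by (simp add: tendsto_cong)
    then show ?thesis
      using 3 by (simp add: has_field_derivative_iff)
  qed
qed

text \<open>The bump is a C^1 profile of the squared distance, hence smooth enough at the centre
  too. The bound \<open>32 / r\<close> is the product of \<open>4\<close> for the profile's
  derivative, \<open>2 * k = 8 / r\<^sup>2\<close>, and \<open>r\<close> for
  \<open>norm (x - p)\<close>.\<close>

lemma C1_bump_exists:
  fixes p :: complex
  assumes r: "r > 0"
  obtains b B where "C1_off {} b B"
    and "\<And>x. x \<in> ball p (r/2) \<Longrightarrow> b x = 1" and "\<And>x. x \<notin> ball p r \<Longrightarrow> b x = 0"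
    and "\<And>x. 0 \<le> b x \<and> b x \<le> 1" and "\<And>x. norm (B x) \<le> 32 / r"
proof -
  define q :: "real \<Rightarrow> real" where "q s = (max 0 s)\<^sup>2" for s
  \<comment> \<open>Since \<open>q (s - 1)\<close> is 0 for \<open>s \<le> 1\<close> and at least 1
    for \<open>s \<ge> 2\<close>, the profile is 1 up to 1 and 0 from 2 on.\<close>
  define \<beta> where "\<beta> s = q (1 - q (s - 1))" for s
  define \<beta>' where "\<beta>' s = - (2 * max 0 (1 - q (s - 1)) * (2 * max 0 (s - 1)))" for s
  \<comment> \<open>This scaling makes \<open>u x\<close> equal to
    \<open>(2 * dist p x / r)\<^sup>2\<close>: at most 1 on the ball of radius \<open>r/2\<close>,
    at least 4 outside \<open>ball p r\<close>.\<close>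
  define k where "k = 4 / r\<^sup>2"
  define u where "u x = k * ((x - p) \<bullet> (x - p))" for x
  define b where "b x = \<beta> (u x)" for x
  define B where "B x = (\<beta>' (u x) * (2 * k)) *\<^sub>R (x - p)" for x
  have q_der: "(q has_real_derivative 2 * max 0 s) (at s)" for s
    unfolding q_def[abs_def] by (rule DERIV_max_0_squared)
  have \<beta>_der: "(\<beta> has_real_derivative \<beta>' s) (at s)" for s
  proof -
    have "((\<lambda>s. q (s - 1)) has_real_derivative 2 * max 0 (s - 1) * 1) (at s)"
      by (rule DERIV_chain2[OF q_der]) (auto intro!: derivative_eq_intros)
    then have "((\<lambda>s. 1 - q (s - 1)) has_real_derivative - (2 * max 0 (s - 1))) (at s)"
      by (auto intro!: derivative_eq_intros)
    from DERIV_chain2[OF q_der this] show ?thesis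
      by (simp add: \<beta>_def[abs_def] \<beta>'_def)
  qed
  have u_der: "(u has_derivative (\<lambda>h. (2 * k) * ((x - p) \<bullet> h))) (at x)" for x
    unfolding u_def[abs_def]
    by (auto intro!: derivative_eq_intros simp: inner_commute)
  have b_der: "(b has_derivative (\<lambda>h. B x \<bullet> h)) (at x)" for x
  proof -
    have "((\<lambda>x. \<beta> (u x)) has_derivative (\<lambda>h. \<beta>' (u x) * ((2 * k) * ((x - p) \<bullet> h)))) (at x)"
      using has_derivative_compose[OF u_der \<beta>_der[unfolded has_field_derivative_def]] by simp
    then show ?thesis
      by (simp add: b_def[abs_def] B_def mult.assoc)
  qed
  have "continuous_on UNIV B"
    unfolding B_def[abs_def] \<beta>'_def u_def q_def by (intro continuous_intros)
  then have "C1_off {} b B"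
    unfolding C1_off_def using b_der
    by (auto intro: continuous_at_imp_continuous_on has_derivative_continuous)
  moreover have u_eq: "u x = (2 * dist p x / r)\<^sup>2" for x
    by (simp add: u_def k_def dist_norm norm_minus_commute power_divide power_mult_distrib flip: power2_norm_eq_inner)
  have u0: "u x \<ge> 0" for x
    by (simp add: u_eq)
  have "b x = 1" if "x \<in> ball p (r/2)" for x
  proof -
    have "u x \<le> 1"
      unfolding u_eq using that r by (intro power_le_one) (auto simp: field_simps)
    then show ?thesis by (simp add: b_def \<beta>_def q_def)
  qed
  moreover have u_large: "u x \<ge> 2" if "x \<notin> ball p r" for x
  proof -
    have "2\<^sup>2 \<le> u x"
      unfolding u_eq using that r by (intro power_mono) (auto simp: field_simps)
    then show ?thesis by simp
  qed
  have q1: "q (s - 1) \<ge> 1" if "s \<ge> 2" for s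
    unfolding q_def using that by (intro one_le_power) auto
  have "b x = 0" if "x \<notin> ball p r" for x
    using q1[OF u_large[OF that]] by (simp add: b_def \<beta>_def q_def max_def)
  moreover have "0 \<le> b x \<and> b x \<le> 1" for x
    by (auto simp: b_def \<beta>_def q_def intro!: power_le_one)
  moreover have "norm (B x) \<le> 32 / r" for x
  proof (cases "x \<in> ball p r")
    case True
    have "\<bar>\<beta>' (u x)\<bar> \<le> 4"
    proof (cases "u x \<ge> 2")
      case True
      then show ?thesis using q1[of "u x"] by (simp add: \<beta>'_def)
    next
      case False
      have "max 0 (1 - q (u x - 1)) * max 0 (u x - 1) \<le> 1 * 1"
        by (intro mult_mono) (use False in \<open>auto simp: q_def\<close>)
      then show ?thesis by (simp add: \<beta>'_def abs_mult)
    qed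
    moreover have "norm (x - p) \<le> r"
      using True by (simp add: dist_norm norm_minus_commute)
    ultimately have "\<bar>\<beta>' (u x)\<bar> * (2 * k) * norm (x - p) \<le> 4 * (2 * k) * r"
      by (intro mult_mono) (auto simp: k_def)
    then show ?thesis
      using r by (simp add: B_def k_def abs_mult power2_eq_square)
  next
    case False
    then have "\<beta>' (u x) = 0"
      using q1[OF u_large] by (simp add: \<beta>'_def)
    then show ?thesis using r by (simp add: B_def)
  qed
  ultimately show ?thesis by (rule that)
qed

section \<open>Smooth boundary pieces\<close>

text \<open>One-sided at the endpoints, like the derivative inside \<open>contour_integral\<close>.
  The orientation condition uses the two-sided derivative, which agrees with it on the open
  interval.\<close>

definition piece_deriv :: "(real \<Rightarrow> complex) \<Rightarrow> real \<Rightarrow> complex" where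
  "piece_deriv \<gamma> t = vector_derivative \<gamma> (at t within {0..1})"

lemma smooth_pieceD:
  assumes "smooth_piece \<gamma>"
  shows "simple_path \<gamma>" and "continuous_on {0..1} \<gamma>" and "continuous_on {0..1} (piece_deriv \<gamma>)"
    and "t \<in> {0..1} \<Longrightarrow> (\<gamma> has_vector_derivative piece_deriv \<gamma> t) (at t within {0..1})"
    and "t \<in> {0..1} \<Longrightarrow> piece_deriv \<gamma> t \<noteq> 0"
proof -
  obtain D where D: "continuous_on {0..1} D"
    "\<And>t. t \<in> {0..1} \<Longrightarrow> (\<gamma> has_vector_derivative D t) (at t within {0..1}) \<and> D t \<noteq> 0"
    using assms unfolding smooth_piece_def by blast
  have eq: "piece_deriv \<gamma> t = D t" if "t \<in> {0..1}" for t
    unfolding piece_deriv_def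
    using D(2)[OF that] that by (intro vector_derivative_within_closed_interval) auto
  show "simple_path \<gamma>" using assms smooth_piece_def by blast
  show "continuous_on {0..1} \<gamma>"
    using D(2) has_vector_derivative_continuous continuous_on_eq_continuous_within by blast
  show "continuous_on {0..1} (piece_deriv \<gamma>)"
    using D(1) eq by (metis (mono_tags, lifting) continuous_on_cong)
  show "(\<gamma> has_vector_derivative piece_deriv \<gamma> t) (at t within {0..1})" if "t \<in> {0..1}"
    using D(2) eq that by simp
  show "piece_deriv \<gamma> t \<noteq> 0" if "t \<in> {0..1}"
    using D(2) eq that by simp
qed

text \<open>Both sides unfold to the same Henstock-Kurzweil integrals, with the same default 0 where
  none exists, so the equality holds for every \<open>g\<close>.\<close>

lemma boundary_integral_eq:
  "boundary_integral \<Gamma> g = (\<Sum>\<gamma>\<in>\<Gamma>. integral {0..1} (\<lambda>t. of_real (g (\<gamma> t)) * piece_deriv \<gamma> t))"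
  by (simp add: boundary_integral_def contour_integral_def contour_integrable_on_def
      has_contour_integral_def integral_def integrable_on_def piece_deriv_def)

lemma negligible_smooth_piece:
  assumes "smooth_piece \<gamma>"
  shows "negligible (path_image \<gamma>)"
  unfolding path_image_def
proof (rule negligible_differentiable_image_lowdim)
  show "\<gamma> differentiable_on {0..1}"
    using smooth_pieceD(4)[OF assms] unfolding differentiable_on_def
    by (meson differentiableI_vector)
qed simp

section \<open>Green's formula\<close>

locale plane_boundary =
  fixes \<Omega> :: "complex set" and \<Gamma> :: "(real \<Rightarrow> complex) set"
  assumes bounded_region: "bounded \<Omega>"
    and boundary: "positively_oriented_boundary \<Omega> \<Gamma>"
begin

lemma finite_pieces: "finite \<Gamma>"
  and smooth_pieces: "\<gamma> \<in> \<Gamma> \<Longrightarrow> smooth_piece \<gamma>"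
  and frontier_eq: "frontier \<Omega> = (\<Union>\<gamma>\<in>\<Gamma>. path_image \<gamma>)"
  and pieces_meet: "\<lbrakk>\<gamma> \<in> \<Gamma>; \<delta> \<in> \<Gamma>; \<gamma> \<noteq> \<delta>\<rbrakk> \<Longrightarrow>
        path_image \<gamma> \<inter> path_image \<delta> \<subseteq> {pathstart \<gamma>, pathfinish \<gamma>} \<inter> {pathstart \<delta>, pathfinish \<delta>}"
proof -
  note b = boundary[unfolded positively_oriented_boundary_def]
  show "finite \<Gamma>" by (rule conjunct1[OF b])
  note b = conjunct2[OF b]
  show "\<gamma> \<in> \<Gamma> \<Longrightarrow> smooth_piece \<gamma>" by (rule bspec[OF conjunct1[OF b]])
  note b = conjunct2[OF b]
  show "frontier \<Omega> = (\<Union>\<gamma>\<in>\<Gamma>. path_image \<gamma>)" by (rule conjunct1[OF b])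
  note b = conjunct1[OF conjunct2[OF b]]
  show "\<lbrakk>\<gamma> \<in> \<Gamma>; \<delta> \<in> \<Gamma>; \<gamma> \<noteq> \<delta>\<rbrakk> \<Longrightarrow>
        path_image \<gamma> \<inter> path_image \<delta> \<subseteq> {pathstart \<gamma>, pathfinish \<gamma>} \<inter> {pathstart \<delta>, pathfinish \<delta>}"
    by (rule b[rule_format])
qed

text \<open>Writing the right-hand point with the factor \<open>-s\<close> puts both points on one
  coordinate line, at \<open>(t, s)\<close> and \<open>(t, -s)\<close>.\<close>

lemma orientation:
  assumes "\<gamma> \<in> \<Gamma>" "t \<in> {0<..<1}"
  shows "\<forall>\<^sub>F s in at_right 0. \<gamma> t + of_real s * (\<i> * piece_deriv \<gamma> t) \<in> \<Omega> \<and>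
           \<gamma> t + of_real (-s) * (\<i> * piece_deriv \<gamma> t) \<notin> \<Omega>"
proof -
  have "(\<gamma> has_vector_derivative piece_deriv \<gamma> t) (at t)"
    using smooth_pieceD(4)[OF smooth_pieces[OF assms(1)], of t] assms(2) at_within_Icc_at[of 0 t 1] by simp
  then have "vector_derivative \<gamma> (at t) = piece_deriv \<gamma> t"
    by (rule vector_derivative_at)
  moreover have "\<forall>\<^sub>F s in at_right 0.
        \<gamma> t + of_real s * (\<i> * vector_derivative \<gamma> (at t)) \<in> \<Omega> \<and>
        \<gamma> t - of_real s * (\<i> * vector_derivative \<gamma> (at t)) \<notin> \<Omega>"
    using boundary assms unfolding positively_oriented_boundary_def by meson
  ultimately show ?thesis by simp
qed

lemma path_image_subset_frontier: "\<gamma> \<in> \<Gamma> \<Longrightarrow> t \<in> {0..1} \<Longrightarrow> \<gamma> t \<in> frontier \<Omega>"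
  unfolding frontier_eq path_image_def by blast

lemma negligible_frontier_region: "negligible (frontier \<Omega>)"
  unfolding frontier_eq
  by (intro negligible_Union finite_imageI finite_pieces) (auto intro: negligible_smooth_piece smooth_pieces)

lemma lmeasurable_region: "\<Omega> \<in> lmeasurable"
  using bounded_region negligible_frontier_region by (rule measurable_Jordan)

text \<open>All endpoints of the parametrizations are included, even the base point of a closed
  piece at which the boundary curve is smooth.\<close>

definition corners :: "complex set" where
  "corners = (\<Union>\<gamma>\<in>\<Gamma>. {pathstart \<gamma>, pathfinish \<gamma>})"

text \<open>For \<open>G = \<nabla>g\<close>, read as a complex number, the classical formula
  \<open>\<integral>\<^sub>\<partial>\<^sub>\<Omega> g (dx + i dy) = \<integral>\<^sub>\<Omega> (i g\<^sub>x - g\<^sub>y)\<close> has right-hand side \<open>i \<integral>\<^sub>\<Omega> \<nabla>g\<close>.\<close>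

definition Green :: "(complex \<Rightarrow> real) \<Rightarrow> (complex \<Rightarrow> complex) \<Rightarrow> bool" where
  "Green g G \<longleftrightarrow> boundary_integral \<Gamma> g = \<i> * integral \<Omega> G"

lemma piece_integrable:
  assumes "\<gamma> \<in> \<Gamma>" "continuous_on UNIV g"
  shows "(\<lambda>t. of_real (g (\<gamma> t)) * piece_deriv \<gamma> t) integrable_on {0..1}"
proof -
  note \<gamma> = smooth_pieceD[OF smooth_pieces[OF assms(1)]]
  have "continuous_on {0..1} (\<lambda>t. g (\<gamma> t))"
    by (rule continuous_on_compose2[OF assms(2) \<gamma>(2)]) auto
  then show ?thesis
    by (intro integrable_continuous_interval continuous_intros \<gamma>(3))
qed

lemma C1_integrable_on:
  assumes "C1_off {} g G"
  shows "G absolutely_integrable_on \<Omega>"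
proof -
  have "continuous_on S G" for S
    using assms unfolding C1_off_def by (auto intro: continuous_on_subset)
  moreover obtain c where "\<Omega> \<subseteq> cbox (-c) c"
    using bounded_subset_cbox_symmetric[OF bounded_region] by blast
  ultimately show ?thesis
    using set_integrable_subset[OF absolutely_integrable_continuous] lmeasurable_region
    by (metis fmeasurableD)
qed

lemma Green_add:
  assumes "C1_off {} f F" "C1_off {} g G" "Green f F" "Green g G"
  shows "Green (\<lambda>x. f x + g x) (\<lambda>x. F x + G x)"
proof -
  have "continuous_on UNIV f" "continuous_on UNIV g"
    using assms C1_off_continuous by blast+
  then have "boundary_integral \<Gamma> (\<lambda>x. f x + g x) = boundary_integral \<Gamma> f + boundary_integral \<Gamma> g"
    by (simp add: boundary_integral_eq distrib_right integral_add piece_integrable sum.distrib)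
  moreover have "integral \<Omega> (\<lambda>x. F x + G x) = integral \<Omega> F + integral \<Omega> G"
    using assms(1,2) C1_integrable_on by (intro integral_add) (auto simp: absolutely_integrable_on_def)
  ultimately show ?thesis
    using assms(3,4) by (simp add: Green_def distrib_left)
qed

section \<open>Green's formula for functions supported near one point\<close>

text \<open>One radius serves all test functions, so a finite subcover can be chosen before
  \<open>g\<close> is cut into pieces.\<close>

definition locally_Green :: "complex \<Rightarrow> real \<Rightarrow> bool" where
  "locally_Green p r \<longleftrightarrow> r > 0 \<and>
     (\<forall>g G. C1_off {} g G \<longrightarrow> (\<forall>x. x \<notin> ball p r \<longrightarrow> g x = 0) \<longrightarrow> Green g G)"

lemma boundary_integral_eq_0:
  assumes "\<And>x. x \<in> frontier \<Omega> \<Longrightarrow> g x = 0"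
  shows "boundary_integral \<Gamma> g = 0"
  unfolding boundary_integral_eq
proof (rule sum.neutral, rule ballI)
  fix \<gamma> assume "\<gamma> \<in> \<Gamma>"
  then have "integral {0..1} (\<lambda>t. of_real (g (\<gamma> t)) * piece_deriv \<gamma> t) = integral {0..1::real} (\<lambda>t. 0)"
    using assms path_image_subset_frontier by (intro integral_cong) auto
  then show "integral {0..1} (\<lambda>t. of_real (g (\<gamma> t)) * piece_deriv \<gamma> t) = 0" by simp
qed

text \<open>Both sides are zero: the support of \<open>g\<close> misses the frontier, and the
  gradient of a compactly supported function has integral zero.\<close>

lemma locally_Green_interior:
  assumes "p \<in> interior \<Omega>"
  shows "\<exists>r. locally_Green p r"
proof -
  obtain r where r: "r > 0" "cball p r \<subseteq> interior \<Omega>"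
    using open_contains_cball[of "interior \<Omega>"] assms by auto
  have "Green g G" if g: "C1_off {} g G" and 0: "\<And>x. x \<notin> ball p r \<Longrightarrow> g x = 0" for g G
  proof -
    \<comment> \<open>The square with centre \<open>p\<close> and side \<open>2 * r\<close> is a
      curved box over its bottom edge \<open>\<gamma>\<close>, with normal \<open>\<i>\<close>;
      \<open>g\<close> vanishes on all four edges.\<close>
    define \<gamma> where "\<gamma> t = p - \<i> * of_real r + of_real t" for t
    let ?K = "(\<lambda>p. \<gamma> (fst p) + of_real (snd p) * \<i>) ` ({-r..r} \<times> {0..2 * r})"
    have far: "g x = 0" if "r \<le> \<bar>Re (x - p)\<bar> \<or> r \<le> \<bar>Im (x - p)\<bar>" for x
      using 0[of x] that abs_Re_le_cmod[of "x - p"] abs_Im_le_cmod[of "x - p"]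
      by (auto simp: dist_norm norm_minus_commute)
    have "(G has_integral (- \<i> * integral {-r..r} (\<lambda>t. of_real (g (\<gamma> t)) * 1))) ?K"
    proof (rule Green_curved_box[OF _ _ _ _ _ g])
      show "(\<gamma> has_vector_derivative 1) (at t within {-r..r})" for t
        unfolding \<gamma>_def[abs_def] has_vector_derivative_def
        by (auto intro!: derivative_eq_intros simp: scaleR_conv_of_real)
    qed (use r far in \<open>auto simp: \<gamma>_def\<close>)
    moreover have "integral {-r..r} (\<lambda>t. of_real (g (\<gamma> t)) * 1) = integral {-r..r} (\<lambda>t. 0::complex)"
      by (intro integral_cong) (use far in \<open>auto simp: \<gamma>_def\<close>)
    ultimately have K: "(G has_integral 0) ?K"
      by simp
    have G0: "G x = 0" if "x \<notin> cball p r" for x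
      by (rule C1_off_gradient_eq_0[OF g, of "- cball p r"]) (use that 0 in auto)
    have "cball p r \<subseteq> ?K"
    proof
      fix x assume "x \<in> cball p r"
      then have "\<bar>Re (x - p)\<bar> \<le> r" "\<bar>Im (x - p)\<bar> \<le> r"
        using abs_Re_le_cmod[of "x - p"] abs_Im_le_cmod[of "x - p"]
        by (auto simp: dist_norm norm_minus_commute)
      then show "x \<in> ?K"
        by (intro image_eqI[of _ _ "(Re (x - p), Im (x - p) + r)"]) (auto simp: \<gamma>_def complex_eq_iff)
    qed
    have "integral \<Omega> G = integral UNIV (\<lambda>x. if x \<in> \<Omega> then G x else 0)"
      by (simp add: integral_restrict_UNIV)
    also have "\<dots> = integral UNIV (\<lambda>x. if x \<in> ?K then G x else 0)"
    proof (rule integral_cong)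
      fix x
      show "(if x \<in> \<Omega> then G x else 0) = (if x \<in> ?K then G x else 0)"
      proof (cases "x \<in> cball p r")
        case True
        then have "x \<in> \<Omega>" "x \<in> ?K"
          using r(2) interior_subset \<open>cball p r \<subseteq> ?K\<close> by blast+
        then show ?thesis by (simp only: if_True)
      next
        case False
        have "G x = 0" by (rule G0[OF False])
        then show ?thesis by (simp only: if_cancel cong: if_cong)
      qed
    qed
    also have "\<dots> = 0"
      using K by (simp only: integral_restrict_UNIV integral_unique)
    finally have "integral \<Omega> G = 0" .
    moreover have "boundary_integral \<Gamma> g = 0"
    proof (rule boundary_integral_eq_0)
      fix x assume "x \<in> frontier \<Omega>"
      then have "x \<notin> interior \<Omega>" by (simp add: frontier_def)
      then show "g x = 0" using 0[of x] r ball_subset_cball[of p r] by blast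
    qed
    ultimately show ?thesis by (simp add: Green_def)
  qed
  then show ?thesis
    using r unfolding locally_Green_def by blast
qed

text \<open>In the coordinates \<open>(t, s)\<close> the frontier near \<open>p\<close> is the line
  \<open>s = 0\<close>, and \<open>\<Omega>\<close> is, up to frontier points, the side
  \<open>s > 0\<close>. Up to a null set the area integral then runs over a curved box.\<close>

lemma locally_Green_frontier:
  assumes p: "p \<in> frontier \<Omega>" "p \<notin> corners"
  shows "\<exists>r. locally_Green p r"
proof -
  obtain \<gamma> t0 where \<gamma>: "\<gamma> \<in> \<Gamma>" and t0: "t0 \<in> {0..1}" and p_eq: "p = \<gamma> t0"
    using p(1) unfolding frontier_eq path_image_def by blast
  note sm = smooth_pieceD[OF smooth_pieces[OF \<gamma>]]
  have "t0 \<noteq> 0" "t0 \<noteq> 1"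
    using p(2) \<gamma> p_eq unfolding corners_def pathstart_def pathfinish_def by auto
  then have t0': "t0 \<in> {0<..<1}"
    using t0 by auto
  define n where "n = \<i> * piece_deriv \<gamma> t0"
  define \<Phi> where "\<Phi> p = \<gamma> (fst p) + of_real (snd p) * n" for p
  have "n \<noteq> 0"
    using sm(5)[OF t0] by (simp add: n_def)
  have "Im (cnj (piece_deriv \<gamma> t0) * n) > 0"
    using sm(5)[OF t0]
    by (simp add: n_def complex_eq_iff flip: power2_eq_square) (metis sum_power2_gt_zero_iff)
  moreover have "isCont (piece_deriv \<gamma>) t0"
    using continuous_on_interior[OF sm(3), of t0] t0' by simp
  then have "((\<lambda>t. Im (cnj (piece_deriv \<gamma> t) * n)) \<longlongrightarrow> Im (cnj (piece_deriv \<gamma> t0) * n)) (at t0)"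
    unfolding isCont_def by (intro tendsto_intros)
  ultimately have "\<forall>\<^sub>F t in at t0. Im (cnj (piece_deriv \<gamma> t) * n) > 0"
    by (rule order_tendstoD(1)[rotated])
  then obtain d where d: "d > 0" "\<And>t. t \<noteq> t0 \<Longrightarrow> dist t t0 < d \<Longrightarrow> Im (cnj (piece_deriv \<gamma> t) * n) > 0"
    unfolding eventually_at by blast
  \<comment> \<open>The first bound keeps the Jacobian positive, the other two keep the parameters
    inside \<open>{0<..<1}\<close>; halving makes all three strict.\<close>
  define \<delta>1 where "\<delta>1 = Min {d / 2, t0 / 2, (1 - t0) / 2}"
  have \<delta>1: "\<delta>1 > 0" "\<delta>1 < d" "\<delta>1 < t0" "\<delta>1 < 1 - t0"
    using d(1) t0' unfolding \<delta>1_def by (auto simp: min_less_iff_disj)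
  let ?I = "{t0 - \<delta>1..t0 + \<delta>1}"
  have I01: "?I \<subseteq> {0..1}"
    using \<delta>1 by auto
  have pos: "Im (cnj (piece_deriv \<gamma> t) * n) > 0" if "t \<in> ?I" for t
    using d(2)[of t] that \<delta>1 \<open>Im (cnj (piece_deriv \<gamma> t0) * n) > 0\<close>
    by (cases "t = t0") (auto simp: dist_real_def)
  have der: "(\<gamma> has_vector_derivative piece_deriv \<gamma> t) (at t within T)" if "t \<in> T" "T \<subseteq> ?I" for t T
    using sm(4)[of t] that I01 has_vector_derivative_within_subset by (metis subsetD subset_trans)
  have inj: "inj_on \<Phi> (?I \<times> UNIV)"
    unfolding \<Phi>_def by (rule inj_on_normal_translates[OF der pos]) auto

  \<comment> \<open>\<open>Z\<close> is what remains of the boundary without a short arc of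
    \<open>\<gamma>\<close> through \<open>p\<close>. It is compact since an open parameter interval
    is removed, and it avoids \<open>p\<close> because \<open>\<gamma>\<close> is simple and
    \<open>p\<close> is not a corner.\<close>
  define Z where "Z = \<gamma> ` ({0..1} - {t0 - \<delta>1<..<t0 + \<delta>1}) \<union> (\<Union>\<delta>\<in>\<Gamma> - {\<gamma>}. path_image \<delta>)"
  have "compact Z"
  proof -
    have "compact ({0..1} - {t0 - \<delta>1<..<t0 + \<delta>1})"
      by (intro compact_diff) auto
    then have "compact (\<gamma> ` ({0..1} - {t0 - \<delta>1<..<t0 + \<delta>1}))"
      by (intro compact_continuous_image continuous_on_subset[OF sm(2)]) auto
    moreover have "compact (path_image \<delta>)" if "\<delta> \<in> \<Gamma> - {\<gamma>}" for \<delta>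
      using smooth_pieceD(1)[OF smooth_pieces] that by (simp add: compact_path_image simple_path_imp_path)
    ultimately show ?thesis
      unfolding Z_def using finite_pieces by (intro compact_Un compact_UN) auto
  qed
  moreover have "p \<notin> Z"
  proof
    assume "p \<in> Z"
    then consider t where "t \<in> {0..1} - {t0 - \<delta>1<..<t0 + \<delta>1}" "p = \<gamma> t"
      | \<delta> where "\<delta> \<in> \<Gamma>" "\<delta> \<noteq> \<gamma>" "p \<in> path_image \<delta>"
      unfolding Z_def by blast
    then show False
    proof cases
      case 1
      then have "t = t0 \<or> t = 0 \<and> t0 = 1 \<or> t = 1 \<and> t0 = 0"
        using sm(1) t0 p_eq unfolding simple_path_def loop_free_def by (metis DiffD1)
      then show False using 1 \<delta>1 t0' by auto
    next
      case 2
      moreover have "p \<in> path_image \<gamma>"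
        using t0 p_eq by (auto simp: path_image_def)
      ultimately have "p \<in> {pathstart \<delta>, pathfinish \<delta>}"
        using pieces_meet[OF 2(1) \<gamma> 2(2)] by blast
      then show False
        using p(2) 2(1) unfolding corners_def by blast
    qed
  qed
  ultimately have "open (- Z)" "p \<in> - Z"
    by (auto simp: compact_imp_closed)
  then obtain r1 where r1: "r1 > 0" "ball p r1 \<subseteq> - Z"
    using open_contains_ball by blast
  have near: "\<exists>t. t0 - \<delta>1 < t \<and> t < t0 + \<delta>1 \<and> x = \<gamma> t" if x: "x \<in> ball p r1" "x \<in> frontier \<Omega>" for x
  proof -
    obtain \<delta> where "\<delta> \<in> \<Gamma>" "x \<in> path_image \<delta>"
      using x(2) frontier_eq by blast
    moreover have "x \<notin> Z" using x(1) r1 by blast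
    ultimately have "x \<in> \<gamma> ` {0..1}" "x \<notin> \<gamma> ` ({0..1} - {t0 - \<delta>1<..<t0 + \<delta>1})"
      unfolding Z_def path_image_def by blast+
    then obtain t where "t \<in> {0..1}" "x = \<gamma> t" "t \<in> {t0 - \<delta>1<..<t0 + \<delta>1}"
      by blast
    then show ?thesis by auto
  qed

  have "isCont \<gamma> t0"
    using continuous_on_interior[OF sm(2), of t0] t0' by simp
  then have "\<forall>\<^sub>F t in at t0. dist (\<gamma> t) p < r1 / 2"
    unfolding p_eq isCont_def using tendstoD r1(1) half_gt_zero by blast
  then obtain d' where d': "d' > 0" "\<And>t. t \<noteq> t0 \<Longrightarrow> dist t t0 < d' \<Longrightarrow> dist (\<gamma> t) p < r1 / 2"
    unfolding eventually_at by blast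
  \<comment> \<open>The shorter arc lies within \<open>r1 / 2\<close> of \<open>p\<close>, and
    \<open>\<delta>2 < \<delta>1\<close> leaves a margin inside the strip on which
    \<open>\<Phi>\<close> is injective.\<close>
  define \<delta>2 where "\<delta>2 = min (\<delta>1 / 2) (d' / 2)"
  have \<delta>2: "\<delta>2 > 0" "\<delta>2 < \<delta>1" "\<delta>2 < d'"
    using d'(1) \<delta>1(1) unfolding \<delta>2_def by (auto simp: min_less_iff_disj)
  let ?J = "{t0 - \<delta>2..t0 + \<delta>2}"
  have J_I: "?J \<subseteq> ?I"
    using \<delta>2 by auto
  \<comment> \<open>A normal displacement up to \<open>\<sigma>\<close> has length at most
    \<open>r1 / 2\<close>; the arc uses up the other half of \<open>r1\<close>.\<close>
  define \<sigma> where "\<sigma> = r1 / (2 * norm n)"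
  have \<sigma>: "\<sigma> > 0"
    using r1 \<open>n \<noteq> 0\<close> by (simp add: \<sigma>_def)
  have in_ball: "\<Phi> (t, s) \<in> ball p r1" if "t \<in> ?J" "\<bar>s\<bar> \<le> \<sigma>" for t s
  proof -
    have "dist (\<gamma> t) p < r1 / 2"
      using d'(2)[of t] that \<delta>2 r1(1) by (cases "t = t0") (auto simp: dist_real_def p_eq)
    moreover have "norm (of_real s * n) \<le> r1 / 2"
    proof -
      have "\<bar>s\<bar> * norm n \<le> \<sigma> * norm n"
        using that(2) by (intro mult_right_mono) auto
      then show ?thesis
        using \<open>n \<noteq> 0\<close> by (simp add: norm_mult \<sigma>_def)
    qed
    ultimately have "norm ((\<gamma> t - p) + of_real s * n) < r1"
      using norm_triangle_ineq[of "\<gamma> t - p" "of_real s * n"] by (simp add: dist_norm)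
    then show ?thesis
      by (simp add: \<Phi>_def dist_norm norm_minus_commute algebra_simps)
  qed
  have on_frontier: "s = 0" if ts: "t \<in> ?J" "\<bar>s\<bar> \<le> \<sigma>" "\<Phi> (t, s) \<in> frontier \<Omega>" for t s
  proof -
    obtain t' where t': "t0 - \<delta>1 < t'" "t' < t0 + \<delta>1" "\<Phi> (t, s) = \<gamma> t'"
      using near[OF in_ball ts(3)] ts by blast
    then have "\<Phi> (t, s) = \<Phi> (t', 0)"
      by (simp add: \<Phi>_def)
    then have "(t, s) = (t', 0)"
      by (rule inj_onD[OF inj]) (use t' ts \<delta>2 in auto)
    then show ?thesis by simp
  qed
  let ?B = "\<lambda>S. {t0 - \<delta>2<..<t0 + \<delta>2} \<times> S"
  have cont\<Phi>: "continuous_on (?I \<times> UNIV) \<Phi>"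
  proof -
    have "continuous_on ?I \<gamma>"
      using sm(2) I01 continuous_on_subset by blast
    then have "continuous_on (?I \<times> (UNIV :: real set)) (\<lambda>p. \<gamma> (fst p))"
      by (rule continuous_on_compose2) (auto intro!: continuous_intros)
    then show ?thesis
      unfolding \<Phi>_def by (intro continuous_intros)
  qed
  have B_sub: "?B S \<subseteq> ?I \<times> UNIV" for S :: "real set"
    using \<delta>2 by auto
  \<comment> \<open>The open box has open image by invariance of domain, as \<open>\<Phi>\<close> is
    only known to be continuous and injective there.\<close>
  define V where "V = \<Phi> ` ?B {-\<sigma><..<\<sigma>}"
  have "open V"
    unfolding V_def
    by (intro invariance_of_domain_gen open_Times continuous_on_subset[OF cont\<Phi>] inj_on_subset[OF inj] B_sub) auto
  moreover have "p \<in> V"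
    unfolding V_def using \<sigma> \<delta>2 by (intro image_eqI[of _ _ "(t0, 0)"]) (auto simp: \<Phi>_def p_eq)
  ultimately obtain r where r: "r > 0" "cball p r \<subseteq> V"
    using open_contains_cball by blast
  \<comment> \<open>Injectivity on the whole strip puts points with coordinates outside the open box
    outside \<open>V\<close>; this is what makes \<open>g\<close> vanish on the sides and the top of
    the curved box.\<close>
  have V_box: "q \<in> ?B {-\<sigma><..<\<sigma>}" if q: "q \<in> ?I \<times> UNIV" "\<Phi> q \<in> V" for q
  proof -
    obtain q' where "q' \<in> ?B {-\<sigma><..<\<sigma>}" "\<Phi> q = \<Phi> q'"
      using \<open>\<Phi> q \<in> V\<close> unfolding V_def by blast
    moreover have "q = q'"
      by (rule inj_onD[OF inj]) (use calculation B_sub q in blast)+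
    ultimately show ?thesis by simp
  qed

  have conn: "connected (\<Phi> ` ?B {a<..<b})" for a b
    by (intro connected_continuous_image continuous_on_subset[OF cont\<Phi>] B_sub convex_connected convex_Times) auto
  have off: "\<Phi> ` ?B {a<..<b} \<inter> frontier \<Omega> = {}" if ab: "0 \<notin> {a<..<b}" "-\<sigma> \<le> a" "b \<le> \<sigma>" for a b
  proof -
    have "\<Phi> (t, s) \<notin> frontier \<Omega>" if "(t, s) \<in> ?B {a<..<b}" for t s
    proof
      assume "\<Phi> (t, s) \<in> frontier \<Omega>"
      then have "s = 0"
        by (rule on_frontier[rotated 2]) (use that ab in auto)
      then show False using that ab(1) by blast
    qed
    then show ?thesis by fast
  qed
  have "\<forall>\<^sub>F s in at_right 0. s < \<sigma>"
    using \<sigma> by (auto intro: eventually_at_right_real[THEN eventually_mono])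
  then have "\<forall>\<^sub>F s in at_right 0. s < \<sigma> \<and> 0 < s \<and> \<Phi> (t0, s) \<in> \<Omega> \<and> \<Phi> (t0, - s) \<notin> \<Omega>"
    using orientation[OF \<gamma> t0'] eventually_at_right_less[of 0]
    by eventually_elim (simp add: \<Phi>_def n_def)
  then obtain s0 where s0: "s0 < \<sigma>" "0 < s0" "\<Phi> (t0, s0) \<in> \<Omega>" "\<Phi> (t0, - s0) \<notin> \<Omega>"
    using eventually_happens'[OF trivial_limit_at_right_real] by blast
  \<comment> \<open>A connected set that misses the frontier lies entirely inside or outside
    \<open>\<Omega>\<close>, so the single point with coordinates \<open>(t0, s0)\<close> decides
    for the whole half-box.\<close>
  have above: "\<Phi> ` ?B {0<..<\<sigma>} \<subseteq> \<Omega>"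
  proof -
    have "\<Phi> (t0, s0) \<in> \<Phi> ` ?B {0<..<\<sigma>}"
      using s0 \<delta>2 by auto
    then show ?thesis
      using connected_Int_frontier[OF conn[of 0 \<sigma>], of \<Omega>] off[of 0 \<sigma>] s0 \<sigma> by auto
  qed
  have below: "\<Phi> ` ?B {-\<sigma><..<0} \<inter> \<Omega> = {}"
  proof -
    have "\<Phi> (t0, - s0) \<in> \<Phi> ` ?B {-\<sigma><..<0}"
      using s0 \<delta>2 by auto
    then show ?thesis
      using connected_Int_frontier[OF conn[of "-\<sigma>" 0], of \<Omega>] off[of "-\<sigma>" 0] s0 \<sigma> by auto
  qed

  have "Green g G" if g: "C1_off {} g G" and 0: "\<And>x. x \<notin> ball p r \<Longrightarrow> g x = 0" for g G
  proof -
    let ?K = "\<Phi> ` (?J \<times> {0..\<sigma>})"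
    have g0: "g x = 0" if "x \<notin> V" for x
      using 0[of x] that r ball_subset_cball by blast
    have g0_box: "g (\<Phi> q) = 0" if "q \<in> ?I \<times> UNIV" "q \<notin> ?B {-\<sigma><..<\<sigma>}" for q
      using g0 V_box that by blast
    have G0: "G x = 0" if "x \<notin> V" for x
      by (rule C1_off_gradient_eq_0[OF g, of "- cball p r"]) (use that 0 r in auto)
    have "(G has_integral (- \<i> * integral ?J (\<lambda>t. of_real (g (\<gamma> t)) * piece_deriv \<gamma> t))) ?K"
      unfolding \<Phi>_def
    proof (rule Green_curved_box[OF _ \<sigma> _ _ _ g])
      show "g (\<gamma> (t0 - \<delta>2) + of_real s * n) = 0 \<and> g (\<gamma> (t0 + \<delta>2) + of_real s * n) = 0" for s
        using g0_box[of "(t0 - \<delta>2, s)"] g0_box[of "(t0 + \<delta>2, s)"] \<delta>2 by (auto simp: \<Phi>_def)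
      show "g (\<gamma> t + of_real \<sigma> * n) = 0" if "t \<in> ?J" for t
        using g0_box[of "(t, \<sigma>)"] J_I that by (auto simp: \<Phi>_def)
    qed (use \<delta>2 der pos J_I I01 in \<open>auto intro: continuous_on_subset[OF sm(3)]\<close>)
    then have K: "integral ?K G = - \<i> * integral ?J (\<lambda>t. of_real (g (\<gamma> t)) * piece_deriv \<gamma> t)"
      by (rule integral_unique)
    have "integral \<Omega> G = integral UNIV (\<lambda>x. if x \<in> \<Omega> then G x else 0)"
      by (simp add: integral_restrict_UNIV)
    \<comment> \<open>Off the null frontier, \<open>\<Omega>\<close> and \<open>?K\<close> agree
      inside \<open>V\<close>, and \<open>G\<close> vanishes outside \<open>V\<close>.\<close>
    also have "\<dots> = integral UNIV (\<lambda>x. if x \<in> ?K then G x else 0)"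
    proof (rule integral_spike[OF negligible_frontier_region])
      fix x assume x: "x \<in> UNIV - frontier \<Omega>"
      show "(if x \<in> ?K then G x else 0) = (if x \<in> \<Omega> then G x else 0)"
      proof (cases "x \<in> V")
        case True
        then obtain t s where ts: "x = \<Phi> (t, s)" "(t, s) \<in> ?B {-\<sigma><..<\<sigma>}"
          unfolding V_def by fast
        have "s \<noteq> 0"
        proof
          assume "s = 0"
          then have "x = \<gamma> t" using ts by (simp add: \<Phi>_def)
          then show False
            using x path_image_subset_frontier[OF \<gamma>, of t] ts(2) J_I I01 \<delta>1 \<delta>2 by auto
        qed
        then consider "s > 0" | "s < 0" by linarith
        then have "x \<in> ?K \<longleftrightarrow> x \<in> \<Omega>"
        proof cases
          case 1
          then have "(t, s) \<in> ?B {0<..<\<sigma>}" "(t, s) \<in> ?J \<times> {0..\<sigma>}"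
            using ts(2) by auto
          then show ?thesis
            using above ts(1) by blast
        next
          case 2
          have "(t, s) \<in> ?B {-\<sigma><..<0}"
            using 2 ts(2) by auto
          then have "x \<in> \<Phi> ` ?B {-\<sigma><..<0}"
            using ts(1) by (rule image_eqI[rotated])
          then have "x \<notin> \<Omega>"
            using below by blast
          moreover have "x \<notin> ?K"
          proof
            assume "x \<in> ?K"
            then obtain q where q: "x = \<Phi> q" "q \<in> ?J \<times> {0..\<sigma>}"
              by (rule imageE)
            have "(t, s) = q"
            proof (rule inj_onD[OF inj])
              show "\<Phi> (t, s) = \<Phi> q" using ts(1) q(1) by simp
              show "(t, s) \<in> ?I \<times> UNIV" using ts(2) B_sub by blast
              show "q \<in> ?I \<times> UNIV" using q(2) J_I by auto
            qed
            then show False using q(2) 2 by auto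
          qed
          ultimately show ?thesis by blast
        qed
        then show ?thesis by (simp only:)
      next
        case False
        have "G x = 0" by (rule G0[OF False])
        then show ?thesis by (simp only: if_cancel cong: if_cong)
      qed
    qed
    also have "\<dots> = integral ?K G"
      by (simp only: integral_restrict_UNIV)
    finally have area: "\<i> * integral \<Omega> G = integral ?J (\<lambda>t. of_real (g (\<gamma> t)) * piece_deriv \<gamma> t)"
      using K by simp
    \<comment> \<open>Parameters in \<open>?I\<close> but not in \<open>?J\<close> have coordinates
      \<open>(t, 0)\<close> outside the open box; those outside \<open>?I\<close> are mapped into
      \<open>Z\<close>, away from \<open>ball p r1\<close>.\<close>
    have g\<gamma>: "g (\<gamma> t) = 0" if "t \<in> {0..1}" "t \<notin> ?J" for t
    proof (cases "t \<in> ?I")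
      case True
      then show ?thesis
        using g0_box[of "(t, 0)"] that by (auto simp: \<Phi>_def)
    next
      case False
      then have "\<gamma> t \<in> Z"
        using that unfolding Z_def by auto
      then have "\<gamma> t \<notin> ball p r1"
        using r1(2) by blast
      moreover have "V \<subseteq> ball p r1"
        unfolding V_def using in_ball by force
      ultimately show ?thesis using g0 by blast
    qed
    have g\<delta>: "g (\<delta> t) = 0" if "\<delta> \<in> \<Gamma> - {\<gamma>}" "t \<in> {0..1}" for \<delta> t
    proof -
      have "\<delta> t \<in> Z"
        using that unfolding Z_def path_image_def by blast
      then have "\<delta> t \<notin> ball p r1"
        using r1(2) by blast
      moreover have "V \<subseteq> ball p r1"
        unfolding V_def using in_ball by force
      ultimately show ?thesis using g0 by blast
    qed
    have "boundary_integral \<Gamma> g = integral {0..1} (\<lambda>t. of_real (g (\<gamma> t)) * piece_deriv \<gamma> t)"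
    proof -
      have "integral {0..1} (\<lambda>t. of_real (g (\<delta> t)) * piece_deriv \<delta> t) = 0" if "\<delta> \<in> \<Gamma> - {\<gamma>}" for \<delta>
      proof -
        have "integral {0..1} (\<lambda>t. of_real (g (\<delta> t)) * piece_deriv \<delta> t) = integral {0..1::real} (\<lambda>t. 0)"
          by (intro integral_cong) (simp add: g\<delta>[OF that])
        then show ?thesis by simp
      qed
      then have "(\<Sum>\<delta>\<in>\<Gamma> - {\<gamma>}. integral {0..1} (\<lambda>t. of_real (g (\<delta> t)) * piece_deriv \<delta> t)) = 0"
        by (rule sum.neutral[rule_format])
      then show ?thesis
        unfolding boundary_integral_eq by (simp only: sum.remove[OF finite_pieces \<gamma>] add_0_right)
    qed
    also have "\<dots> = integral {0..1} (\<lambda>t. if t \<in> ?J then of_real (g (\<gamma> t)) * piece_deriv \<gamma> t else 0)"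
      by (intro integral_cong) (use g\<gamma> in \<open>simp split: if_split del: atLeastAtMost_iff\<close>)
    also have "\<dots> = integral ?J (\<lambda>t. of_real (g (\<gamma> t)) * piece_deriv \<gamma> t)"
    proof -
      have "?J \<inter> {0..1} = ?J" using J_I I01 by blast
      then show ?thesis by (simp only: integral_restrict_Int)
    qed
    finally show ?thesis
      using area by (simp add: Green_def)
  qed
  then show ?thesis
    using r(1) unfolding locally_Green_def by blast
qed


section \<open>Gluing the local formulas\<close>

text \<open>A partition of unity, one ball at a time: \<open>g = b * g + (1 - b) * g\<close>. The
  first summand is supported in \<open>ball p (r p)\<close>; the second vanishes where
  \<open>b\<close> is 1, so within \<open>closure \<Omega>\<close> the balls left in
  \<open>F\<close> cover its nonzero set. The half radius leaves room for the descent of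
  \<open>b\<close>.\<close>

lemma Green_finite_cover:
  assumes "finite F" and "\<And>p. p \<in> F \<Longrightarrow> locally_Green p (r p)"
    and "C1_off {} g G" and "\<And>x. x \<in> closure \<Omega> \<Longrightarrow> g x \<noteq> 0 \<Longrightarrow> \<exists>p\<in>F. x \<in> ball p (r p / 2)"
  shows "Green g G"
  using assms
proof (induction F arbitrary: g G rule: finite_induct)
  case empty
  then have 0: "g x = 0" if "x \<in> closure \<Omega>" for x
    using that by blast
  \<comment> \<open>Vanishing of \<open>g\<close> on \<open>closure \<Omega>\<close> controls the
    gradient only at interior points; the rest of \<open>\<Omega>\<close> is a null set.\<close>
  have "G x = 0" if "x \<in> \<Omega> - frontier \<Omega>" for x
  proof (rule C1_off_gradient_eq_0[OF empty.prems(2), of "interior \<Omega>"])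
    show "x \<in> interior \<Omega>"
      using that closure_subset by (auto simp: frontier_def)
    show "g y = 0" if "y \<in> interior \<Omega>" for y
      using 0 that interior_subset closure_subset by blast
  qed auto
  then have "integral \<Omega> G = integral \<Omega> (\<lambda>_. 0)"
    by (intro integral_spike[OF negligible_frontier_region]) auto
  moreover have "boundary_integral \<Gamma> g = 0"
    using 0 by (intro boundary_integral_eq_0) (auto simp: frontier_def)
  ultimately show ?case by (simp add: Green_def)
next
  case (insert p F)
  have "r p > 0" "locally_Green p (r p)"
    using insert.prems(1)[of p] by (auto simp: locally_Green_def)
  then obtain b B where b: "C1_off {} b B" "\<And>x. x \<in> ball p (r p / 2) \<Longrightarrow> b x = 1"
    "\<And>x. x \<notin> ball p (r p) \<Longrightarrow> b x = 0"
    using C1_bump_exists by metis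
  note g = insert.prems(2)
  note c1 = C1_off_mult[OF b(1) g]
  note c2 = C1_off_mult[OF C1_off_diff[OF C1_off_const[of _ 1] b(1)] g]
  have "Green (\<lambda>x. b x * g x) (\<lambda>x. b x *\<^sub>R G x + g x *\<^sub>R B x)"
    using \<open>locally_Green p (r p)\<close> c1 b(3) unfolding locally_Green_def by simp
  moreover have "Green (\<lambda>x. (1 - b x) * g x) (\<lambda>x. (1 - b x) *\<^sub>R G x + g x *\<^sub>R (0 - B x))"
  proof (rule insert.IH[OF _ c2])
    fix x assume "x \<in> closure \<Omega>" "(1 - b x) * g x \<noteq> 0"
    then have "x \<notin> ball p (r p / 2)" "\<exists>q\<in>insert p F. x \<in> ball q (r q / 2)"
      using b(2)[of x] insert.prems(3)[of x] by auto
    then show "\<exists>q\<in>F. x \<in> ball q (r q / 2)" by blast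
  qed (use insert.prems(1) in blast)
  ultimately have "Green (\<lambda>x. b x * g x + (1 - b x) * g x)
      (\<lambda>x. (b x *\<^sub>R G x + g x *\<^sub>R B x) + ((1 - b x) *\<^sub>R G x + g x *\<^sub>R (0 - B x)))"
    by (rule Green_add[OF c1 c2])
  then show ?case
    by (simp add: algebra_simps)
qed

lemma finite_corners: "finite corners"
  unfolding corners_def using finite_pieces by auto

text \<open>Deleting open neighbourhoods of the corners on which \<open>g\<close> vanishes leaves a
  compact part of \<open>closure \<Omega>\<close> consisting of interior and regular boundary
  points.\<close>

lemma Green_away_from_corners:
  assumes g: "C1_off {} g G" and 0: "\<And>c. c \<in> corners \<Longrightarrow> \<forall>\<^sub>F x in nhds c. g x = 0"
  shows "Green g G"
proof -
  obtain U where U: "\<And>c. c \<in> corners \<Longrightarrow> open (U c) \<and> c \<in> U c \<and> (\<forall>x\<in>U c. g x = 0)"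
    using 0 unfolding eventually_nhds by metis
  define S where "S = closure \<Omega> - (\<Union>c\<in>corners. U c)"
  have "compact S"
    unfolding S_def using U bounded_region by (intro compact_diff open_UN) (auto simp: compact_closure)
  have "\<exists>r. locally_Green p r" if "p \<in> S" for p
  proof (cases "p \<in> interior \<Omega>")
    case False
    then have "p \<in> frontier \<Omega>" "p \<notin> corners"
      using that U unfolding S_def frontier_def by auto
    then show ?thesis by (rule locally_Green_frontier)
  qed (rule locally_Green_interior)
  then obtain r where r: "\<And>p. p \<in> S \<Longrightarrow> locally_Green p (r p)"
    by metis
  then have r0: "r p > 0" if "p \<in> S" for p
    using that unfolding locally_Green_def by blast
  obtain F where F: "F \<subseteq> S" "finite F" "S \<subseteq> (\<Union>p\<in>F. ball p (r p / 2))"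
  proof (rule compactE_image[OF \<open>compact S\<close>, of S "\<lambda>p. ball p (r p / 2)"])
    show "S \<subseteq> (\<Union>p\<in>S. ball p (r p / 2))"
      using r0 by force
  qed auto
  show ?thesis
  proof (rule Green_finite_cover[OF F(2) _ g])
    show "locally_Green p (r p)" if "p \<in> F" for p
      using r F(1) that by blast
    show "\<exists>p\<in>F. x \<in> ball p (r p / 2)" if "x \<in> closure \<Omega>" "g x \<noteq> 0" for x
      using that U F(3) unfolding S_def by blast
  qed
qed

section \<open>Corners and isolated singularities\<close>

lemma bounded_gradient_integrable_on:
  assumes "finite A" and g: "C1_off A g G" and M: "\<And>x. x \<in> \<Omega> - A \<Longrightarrow> norm (G x) \<le> M"
  shows "G integrable_on (\<Omega> - A)"
proof -
  have \<Omega>A: "\<Omega> - A \<in> lmeasurable"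
    using lmeasurable_region \<open>finite A\<close> by (intro fmeasurable.Diff) (auto simp: finite_imp_compact lmeasurable_compact)
  have "G absolutely_integrable_on (\<Omega> - A)"
  proof (rule measurable_bounded_by_integrable_imp_absolutely_integrable)
    show "G \<in> borel_measurable (lebesgue_on (\<Omega> - A))"
      using g \<Omega>A unfolding C1_off_def
      by (intro continuous_imp_measurable_on_sets_lebesgue) (auto intro: continuous_on_subset)
    show "(\<lambda>_. M) integrable_on (\<Omega> - A)"
      using \<Omega>A by (rule integrable_on_const)
  qed (use \<Omega>A M in auto)
  then show ?thesis by (simp add: absolutely_integrable_on_def)
qed

lemma integral_remove_finite: "finite A \<Longrightarrow> integral (\<Omega> - A) f = integral \<Omega> f" for f :: "complex \<Rightarrow> complex"
  by (rule integral_spike_set; rule negligible_subset[OF negligible_finite]) auto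

text \<open>A point singularity is invisible to Green's formula: cutting it off by a bump function of
  radius \<open>r\<close> costs a gradient of size \<open>O(1/r)\<close> on a disc of area \<open>O(r\<^sup>2)\<close>.\<close>

lemma Green_bounded_gradient:
  assumes "finite A" and "C1_off A g G" and "\<exists>M. \<forall>x\<in>\<Omega> - A. norm (G x) \<le> M"
    and "\<And>c. c \<in> corners - A \<Longrightarrow> \<forall>\<^sub>F x in nhds c. g x = 0"
  shows "Green g G"
  using assms
proof (induction A arbitrary: g G rule: finite_induct)
  case empty
  then show ?case by (intro Green_away_from_corners) auto
next
  case (insert c A)
  note g = insert.prems(1)
  obtain M where M: "\<And>x. x \<in> \<Omega> - insert c A \<Longrightarrow> norm (G x) \<le> M"
    using insert.prems(2) by blast
  have contg: "continuous_on S g" for S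
    using g by (rule C1_off_continuous)
  have "compact (g ` closure \<Omega>)"
    using bounded_region by (intro compact_continuous_image contg) (simp add: compact_closure)
  then obtain N where N: "N > 0" "\<And>x. x \<in> closure \<Omega> \<Longrightarrow> \<bar>g x\<bar> \<le> N"
    using compact_imp_bounded bounded_pos by (metis imageI real_norm_def)
  define r where "r k = 1 / (real k + 1)" for k :: nat
  have r0: "r k > 0" for k by (simp add: r_def)
  have "\<exists>b B. C1_off {} b B \<and> (\<forall>x\<in>ball c (r k / 2). b x = 1) \<and> (\<forall>x. x \<notin> ball c (r k) \<longrightarrow> b x = 0) \<and>
      (\<forall>x. 0 \<le> b x \<and> b x \<le> 1) \<and> (\<forall>x. norm (B x) \<le> 32 / r k)" for k
    using C1_bump_exists[OF r0[of k], of c] by metis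
  then obtain b B where b: "\<And>k. C1_off {} (b k) (B k)"
      "\<And>k x. x \<in> ball c (r k / 2) \<Longrightarrow> b k x = 1"
      "\<And>k x. x \<notin> ball c (r k) \<Longrightarrow> b k x = 0"
      "\<And>k x. 0 \<le> b k x \<and> b k x \<le> 1" "\<And>k x. norm (B k x) \<le> 32 / r k"
    by metis
  \<comment> \<open>The cut-off function vanishes on a ball around \<open>c\<close>, so it is
    differentiable at \<open>c\<close> with gradient 0 and its exceptional set shrinks to
    \<open>A\<close>, as the induction requires.\<close>
  define g' where "g' k x = (1 - b k x) * g x" for k x
  define G' where "G' k x = (if x = c then 0 else (1 - b k x) *\<^sub>R G x + g x *\<^sub>R (0 - B k x))" for k x
  have prod: "C1_off (insert c A) (g' k) (\<lambda>x. (1 - b k x) *\<^sub>R G x + g x *\<^sub>R (0 - B k x))" for k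
    unfolding g'_def[abs_def]
    by (rule C1_off_mult[OF C1_off_diff[OF C1_off_const C1_off_mono[OF b(1)]] g]) auto
  have B0: "B k x = 0" if "x \<in> ball c (r k / 2)" for k x
  proof -
    have "0 - B k x = 0"
      by (rule C1_off_gradient_eq_0[OF C1_off_diff[OF C1_off_const[of _ 1] b(1)], of "ball c (r k / 2)"])
        (use that b(2) in auto)
    then show ?thesis by simp
  qed
  have G'0: "G' k x = 0" if "x \<in> ball c (r k / 2)" for k x
    using that b(2) B0 by (simp add: G'_def)
  have g'0: "g' k x = 0" if "x \<in> ball c (r k / 2)" for k x
    using that b(2) by (simp add: g'_def)
  have c_ball: "c \<in> ball c (r k / 2)" for k
    using r0[of k] by simp
  have g': "C1_off A (g' k) (G' k)" for k
    unfolding C1_off_def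
  proof (intro conjI ballI)
    show "continuous_on UNIV (g' k)"
      using prod by (rule C1_off_continuous)
    have "continuous_on (- insert c A) (G' k)"
    proof -
      have "continuous_on (- insert c A) (\<lambda>x. (1 - b k x) *\<^sub>R G x + g x *\<^sub>R (0 - B k x))"
        using prod[of k] unfolding C1_off_def by (rule conjunct1[OF conjunct2])
      then show ?thesis
        by (rule continuous_on_eq) (simp add: G'_def)
    qed
    moreover have "continuous_on (ball c (r k / 2)) (G' k)"
      by (rule continuous_on_eq[OF continuous_on_const[of _ 0]]) (metis G'0)
    moreover have "open (- insert c A)"
      by (intro open_Compl finite_imp_closed) (use insert.hyps(1) in simp)
    ultimately have "continuous_on (- insert c A \<union> ball c (r k / 2)) (G' k)"
      by (intro continuous_on_open_Un) auto
    then show "continuous_on (- A) (G' k)"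
      by (rule continuous_on_subset) (use c_ball in auto)
    fix x assume x: "x \<in> - A"
    show "(g' k has_derivative (\<lambda>h. G' k x \<bullet> h)) (at x)"
    proof (cases "x = c")
      case True
      have "((\<lambda>_. 0) has_derivative (\<lambda>h. G' k x \<bullet> h)) (at x)"
        using True by (simp add: G'_def)
      then show ?thesis
        by (rule has_derivative_transform_within_open[where s = "ball c (r k / 2)"])
          (use True c_ball g'0 in auto)
    next
      case False
      then show ?thesis
        using prod[of k] x unfolding C1_off_def by (auto simp: G'_def)
    qed
  qed
  have diff_bound: "norm (G x - G' k x) \<le> (if x \<in> cball c (r k) then M + N * (32 / r k) else 0)"
    if x: "x \<in> \<Omega> - insert c A" for k x
  proof -
    have eq: "G x - G' k x = b k x *\<^sub>R G x + g x *\<^sub>R B k x"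
      using x by (simp add: G'_def algebra_simps)
    show ?thesis
    proof (cases "x \<in> cball c (r k)")
      case True
      have "norm (b k x *\<^sub>R G x) \<le> 1 * M"
        unfolding norm_scaleR using b(4)[of k x] M[OF x] by (intro mult_mono) auto
      moreover have "norm (g x *\<^sub>R B k x) \<le> N * (32 / r k)"
        unfolding norm_scaleR using N(1) N(2)[of x] b(5)[of k x] x closure_subset
        by (intro mult_mono) auto
      ultimately show ?thesis
        unfolding eq using True norm_triangle_ineq[of "b k x *\<^sub>R G x" "g x *\<^sub>R B k x"] by simp
    next
      case False
      have "B k x = 0"
        by (rule C1_off_gradient_eq_0[OF b(1), of "- cball c (r k)"]) (use False b(3) in auto)
      moreover have "b k x = 0"
        using False b(3)[of x k] by auto
      ultimately show ?thesis
        using False by (simp add: eq)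
    qed
  qed
  have M0: "\<exists>M. \<forall>x\<in>\<Omega> - A. norm (G' k x) \<le> M" for k
  proof (intro exI ballI)
    fix x assume x: "x \<in> \<Omega> - A"
    \<comment> \<open>The absolute value is taken because \<open>M\<close> could be negative if
      \<open>\<Omega> - insert c A\<close> were empty.\<close>
    show "norm (G' k x) \<le> \<bar>M\<bar> + (\<bar>M\<bar> + N * (32 / r k))"
    proof (cases "x = c")
      case True
      then show ?thesis using N(1) r0[of k] by (simp add: G'_def)
    next
      case False
      have "norm (G' k x) \<le> norm (G x) + norm (G x - G' k x)"
        using norm_triangle_ineq4[of "G x" "G x - G' k x"] by simp
      moreover have "norm (G x) \<le> \<bar>M\<bar>"
        using M[of x] x False by auto
      moreover have "norm (G x - G' k x) \<le> \<bar>M\<bar> + N * (32 / r k)"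
        using diff_bound[of x k] x False N(1) r0[of k] by (auto split: if_splits)
      ultimately show ?thesis by linarith
    qed
  qed
  have Gr: "Green (g' k) (G' k)" for k
  proof (rule insert.IH[OF g' M0])
    fix d assume d: "d \<in> corners - A"
    show "\<forall>\<^sub>F x in nhds d. g' k x = 0"
    proof (cases "d = c")
      \<comment> \<open>If \<open>c\<close> is a corner, the cut-off itself supplies the vanishing
        near it that is not assumed for \<open>g\<close>.\<close>
      case True
      then show ?thesis
        using g'0 c_ball unfolding eventually_nhds by (intro exI[of _ "ball c (r k / 2)"]) auto
    next
      case False
      then have "\<forall>\<^sub>F x in nhds d. g x = 0"
        using d insert.prems(3) by blast
      then show ?thesis
        by eventually_elim (simp add: g'_def)
    qed
  qed

  have "(\<lambda>k. integral \<Omega> (G' k)) \<longlonglongrightarrow> integral \<Omega> G"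
  proof -
    let ?S = "\<Omega> - insert c A"
    have fin: "finite (insert c A)"
      using insert.hyps by simp
    have iG: "G integrable_on ?S"
      using bounded_gradient_integrable_on[OF fin g M] .
    have iG': "G' k integrable_on ?S" for k
    proof -
      obtain M' where "\<And>x. x \<in> \<Omega> - A \<Longrightarrow> norm (G' k x) \<le> M'"
        using M0 by blast
      then show ?thesis
        by (intro bounded_gradient_integrable_on[OF fin C1_off_mono[OF g']]) auto
    qed
    have "norm (integral \<Omega> (G' k) - integral \<Omega> G) \<le> (\<bar>M\<bar> + N * (32 / r k)) * (pi * (r k)\<^sup>2)" for k
    proof -
      let ?C = "\<bar>M\<bar> + N * (32 / r k)"
      have C: "?C \<ge> 0" using N(1) r0[of k] by simp
      have disc: "((\<lambda>x. if x \<in> cball c (r k) then ?C else 0) has_integral ?C * (pi * (r k)\<^sup>2)) UNIV"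
      proof -
        have "((\<lambda>_. 1) has_integral measure lborel (cball c (r k))) (cball c (r k))"
          by (intro has_integral_measure_lborel emeasure_lborel_cball_finite) auto
        then have "((\<lambda>_. ?C * 1) has_integral ?C * measure lborel (cball c (r k))) (cball c (r k))"
          by (rule has_integral_mult_right)
        then have "((\<lambda>_. ?C) has_integral ?C * measure lborel (cball c (r k))) (cball c (r k))"
          by simp
        moreover have "measure lborel (cball c (r k)) = pi * (r k)\<^sup>2"
          using content_cball[of "r k" c] r0[of k] by (simp add: unit_ball_vol_2)
        ultimately show ?thesis by (simp only: has_integral_restrict_UNIV)
      qed
      have "norm (integral \<Omega> (G' k) - integral \<Omega> G) = norm (integral ?S (\<lambda>x. G x - G' k x))"
        by (simp only: integral_diff[OF iG iG'] integral_remove_finite[OF fin, symmetric] norm_minus_commute)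
      also have "integral ?S (\<lambda>x. G x - G' k x) = integral UNIV (\<lambda>x. if x \<in> ?S then G x - G' k x else 0)"
        by (simp only: integral_restrict_UNIV)
      also have "norm \<dots> \<le> integral UNIV (\<lambda>x. if x \<in> cball c (r k) then ?C else 0)"
      proof (rule integral_norm_bound_integral)
        show "(\<lambda>x. if x \<in> ?S then G x - G' k x else 0) integrable_on UNIV"
          using integrable_diff[OF iG iG'] by (simp only: integrable_restrict_UNIV)
        show "(\<lambda>x. if x \<in> cball c (r k) then ?C else 0) integrable_on UNIV"
          using disc by blast
        show "norm (if x \<in> ?S then G x - G' k x else 0) \<le> (if x \<in> cball c (r k) then ?C else 0)" for x
          using diff_bound[of x k] C by (auto split: if_splits)
      qed
      also have "\<dots> = ?C * (pi * (r k)\<^sup>2)"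
        using disc by (rule integral_unique)
      finally show ?thesis .
    qed
    moreover have "(\<lambda>k. (\<bar>M\<bar> + N * (32 / r k)) * (pi * (r k)\<^sup>2)) \<longlonglongrightarrow> 0"
    proof -
      have "r \<longlonglongrightarrow> 0"
        unfolding r_def[abs_def] using LIMSEQ_inverse_real_of_nat by (simp add: inverse_eq_divide add.commute)
      then have "(\<lambda>k. \<bar>M\<bar> * pi * (r k)\<^sup>2 + N * 32 * pi * r k) \<longlonglongrightarrow> \<bar>M\<bar> * pi * 0\<^sup>2 + N * 32 * pi * 0"
        by (intro tendsto_intros)
      moreover have "(\<bar>M\<bar> + N * (32 / r k)) * (pi * (r k)\<^sup>2) = \<bar>M\<bar> * pi * (r k)\<^sup>2 + N * 32 * pi * r k" for k
        using r0[of k] by (simp add: field_simps power2_eq_square)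
      ultimately show ?thesis by simp
    qed
    ultimately show ?thesis
      by (intro LIM_zero_cancel[of _ "integral \<Omega> G"] Lim_null_comparison[of "\<lambda>k. integral \<Omega> (G' k) - integral \<Omega> G"])
        (auto intro: always_eventually)
  qed
  then have "(\<lambda>k. \<i> * integral \<Omega> (G' k)) \<longlonglongrightarrow> \<i> * integral \<Omega> G"
    by (intro tendsto_intros)
  moreover have "(\<lambda>k. boundary_integral \<Gamma> (g' k)) \<longlonglongrightarrow> boundary_integral \<Gamma> g"
    unfolding boundary_integral_eq
  proof (rule tendsto_sum)
    fix \<gamma> assume \<gamma>: "\<gamma> \<in> \<Gamma>"
    note sm = smooth_pieceD[OF smooth_pieces[OF \<gamma>]]
    let ?f = "\<lambda>t. of_real (g (\<gamma> t)) * piece_deriv \<gamma> t"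
    let ?f' = "\<lambda>k t. of_real (g' k (\<gamma> t)) * piece_deriv \<gamma> t"
    \<comment> \<open>A simple path meets \<open>c\<close> at most once, apart from the two
      parameters 0 and 1. Only at these finitely many parameters can the pointwise limit differ from
      the wanted integrand, as every \<open>g' k\<close> is 0 at \<open>c\<close>.\<close>
    define E where "E = {t \<in> {0..1}. \<gamma> t = c}"
    have "finite E"
    proof (cases "E \<subseteq> {0, 1}")
      case False
      then obtain t where t: "t \<in> E" "t \<noteq> 0" "t \<noteq> 1" by blast
      have "E \<subseteq> {t}"
        using sm(1) t unfolding E_def simple_path_def loop_free_def by fastforce
      then show ?thesis using finite_subset by blast
    qed (use finite_subset in blast)
    have lim: "(\<lambda>k. ?f' k t) \<longlonglongrightarrow> (if t \<in> E then 0 else ?f t)" if t: "t \<in> {0..1}" for t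
    proof (cases "t \<in> E")
      case True
      then have "g' k (\<gamma> t) = 0" for k
        using g'0[OF c_ball] by (simp add: E_def)
      then show ?thesis using True by simp
    next
      case False
      then have "dist c (\<gamma> t) > 0"
        using t by (auto simp: E_def)
      moreover have "r \<longlonglongrightarrow> 0"
        unfolding r_def[abs_def] using LIMSEQ_inverse_real_of_nat by (simp add: inverse_eq_divide add.commute)
      ultimately have "\<forall>\<^sub>F k in sequentially. r k < dist c (\<gamma> t)"
        by (intro order_tendstoD)
      then have "\<forall>\<^sub>F k in sequentially. ?f' k t = ?f t"
        by eventually_elim (simp add: g'_def b(3))
      then show ?thesis
        using False tendsto_eventually by (simp only: if_False)
    qed
    have "(\<lambda>k. integral {0..1} (?f' k)) \<longlonglongrightarrow> integral {0..1} (\<lambda>t. if t \<in> E then 0 else ?f t)"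
    proof (rule dominated_convergence(2))
      show "?f' k integrable_on {0..1}" for k
        using piece_integrable[OF \<gamma> C1_off_continuous[OF g']] .
      show "(\<lambda>t. N * norm (piece_deriv \<gamma> t)) integrable_on {0..1}"
        by (intro integrable_continuous_interval continuous_intros sm(3))
      show "norm (?f' k t) \<le> N * norm (piece_deriv \<gamma> t)" if "t \<in> {0..1}" for k t
      proof -
        have "\<gamma> t \<in> closure \<Omega>"
          using path_image_subset_frontier[OF \<gamma> that] by (simp add: frontier_def)
        then have "\<bar>g' k (\<gamma> t)\<bar> \<le> 1 * N"
          unfolding g'_def abs_mult using b(4)[of k "\<gamma> t"] N(2)[of "\<gamma> t"] by (intro mult_mono) auto
        then show ?thesis
          unfolding norm_mult by (intro mult_right_mono) auto
      qed
    qed (rule lim)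
    also have "integral {0..1} (\<lambda>t. if t \<in> E then 0 else ?f t) = integral {0..1} ?f"
      by (rule integral_spike[OF negligible_finite[OF \<open>finite E\<close>]]) auto
    finally show "(\<lambda>k. integral {0..1} (?f' k)) \<longlonglongrightarrow> integral {0..1} ?f" .
  qed
  ultimately show ?case
    using Gr unfolding Green_def by (metis (no_types, lifting) LIMSEQ_unique ext)
qed

end

section \<open>The geometric median\<close>

lemma C1_off_dist: "C1_off {m} (\<lambda>P. dist P m) (\<lambda>P. sgn (P - m))"
  unfolding C1_off_def dist_norm
proof (intro conjI ballI)
  fix x assume "x \<in> - {m}"
  then have "(norm has_derivative (\<lambda>h. sgn (x - m) \<bullet> h)) (at (x - m))"
    using has_derivative_norm[of "x - m"] by (simp add: inner_commute)
  moreover have "((\<lambda>P. P - m) has_derivative (\<lambda>h. h)) (at x)"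
    by (auto intro!: derivative_eq_intros)
  ultimately show "((\<lambda>P. norm (P - m)) has_derivative (\<lambda>h. sgn (x - m) \<bullet> h)) (at x)"
    by (rule has_derivative_compose[rotated])
qed (auto intro!: continuous_intros)

text \<open>The expression equals \<open>norm (P - X) - (P - X) \<bullet> sgn (P - m)\<close>, so
  Cauchy-Schwarz applies. Equality would make \<open>P - X\<close> a multiple of
  \<open>P - m\<close>, placing \<open>P\<close> on the line through \<open>m\<close> and
  \<open>X\<close>. At \<open>P = m\<close> the convention \<open>sgn 0 = 0\<close> still gives a
  subgradient.\<close>

lemma dist_subgradient:
  fixes P X m :: complex
  shows "0 \<le> dist P X - dist P m + sgn (P - m) \<bullet> (X - m)"
    and "Im (cnj (P - m) * (X - m)) \<noteq> 0 \<Longrightarrow> 0 < dist P X - dist P m + sgn (P - m) \<bullet> (X - m)"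
proof -
  have self: "sgn (P - m) \<bullet> (P - m) = norm (P - m)"
    by (cases "P = m") (auto simp: sgn_div_norm power2_eq_square simp flip: power2_norm_eq_inner)
  have eq: "dist P X - dist P m + sgn (P - m) \<bullet> (X - m) = norm (P - X) - (P - X) \<bullet> sgn (P - m)"
    using self by (simp add: dist_norm inner_diff_left inner_diff_right inner_commute)
  have "(P - X) \<bullet> sgn (P - m) \<le> norm (P - X) * norm (sgn (P - m))"
    by (rule norm_cauchy_schwarz)
  also have "\<dots> \<le> norm (P - X)"
    by (simp add: norm_sgn)
  finally have le: "(P - X) \<bullet> sgn (P - m) \<le> norm (P - X)" .
  then show "0 \<le> dist P X - dist P m + sgn (P - m) \<bullet> (X - m)"
    by (simp add: eq)
  assume det: "Im (cnj (P - m) * (X - m)) \<noteq> 0"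
  have "(P - X) \<bullet> sgn (P - m) \<noteq> norm (P - X)"
  proof
    assume "(P - X) \<bullet> sgn (P - m) = norm (P - X)"
    moreover have "P \<noteq> m" using det by auto
    ultimately have "norm (P - X) *\<^sub>R sgn (P - m) = P - X"
      using norm_cauchy_schwarz_eq[of "P - X" "sgn (P - m)"] by (simp add: norm_sgn)
    then obtain c where c: "P - X = c *\<^sub>R (P - m)"
      by (metis scaleR_scaleR sgn_div_norm)
    have eq: "X - m = (1 - c) *\<^sub>R (P - m)"
      using c by (simp add: algebra_simps)
    have "Im (cnj (P - m) * (X - m)) = 0"
      unfolding eq by (simp add: algebra_simps)
    then show False using det by blast
  qed
  then show "0 < dist P X - dist P m + sgn (P - m) \<bullet> (X - m)"
    using le by (simp add: eq)
qed

context plane_boundary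
begin

text \<open>With \<open>m\<close> and all corners exceptional, no corner is left at which the
  function would have to vanish, and the gradient has norm at most 1. The point \<open>m\<close> may
  lie anywhere, also on the boundary.\<close>

lemma boundary_integral_dist:
  "boundary_integral \<Gamma> (\<lambda>P. dist P m) = \<i> * integral \<Omega> (\<lambda>P. sgn (P - m))"
proof -
  have "Green (\<lambda>P. dist P m) (\<lambda>P. sgn (P - m))"
  proof (rule Green_bounded_gradient[of "insert m corners"])
    show "finite (insert m corners)"
      using finite_corners by simp
    show "C1_off (insert m corners) (\<lambda>P. dist P m) (\<lambda>P. sgn (P - m))"
      by (rule C1_off_mono[OF C1_off_dist]) auto
    show "\<exists>M. \<forall>x\<in>\<Omega> - insert m corners. norm (sgn (x - m)) \<le> M"
      by (intro exI[of _ 1]) (simp add: norm_sgn)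
  qed auto
  then show ?thesis by (simp add: Green_def)
qed

lemma sgn_integrable_on: "(\<lambda>P. sgn (P - X)) integrable_on \<Omega>"
proof -
  have "(\<lambda>P. sgn (P - X)) integrable_on (\<Omega> - {X})"
    by (rule bounded_gradient_integrable_on[OF _ C1_off_dist, of _ 1]) (auto simp: norm_sgn)
  then show ?thesis
    by (rule integrable_spike_set) (auto intro: negligible_subset[of "{X}"])
qed

lemma dist_integral_eq: "dist_integral \<Omega> X = integral \<Omega> (\<lambda>P. dist P X)"
  and dist_integrable_on: "(\<lambda>P. dist P X) integrable_on \<Omega>"
proof -
  obtain c where "\<Omega> \<subseteq> cbox (-c) c"
    using bounded_subset_cbox_symmetric[OF bounded_region] by blast
  moreover have "(\<lambda>P. dist P X) absolutely_integrable_on cbox (-c) c"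
    by (intro absolutely_integrable_continuous continuous_intros)
  ultimately have "(\<lambda>P. dist P X) absolutely_integrable_on \<Omega>"
    using lmeasurable_region by (metis fmeasurableD set_integrable_subset)
  then show "dist_integral \<Omega> X = integral \<Omega> (\<lambda>P. dist P X)" "(\<lambda>P. dist P X) integrable_on \<Omega>"
    unfolding dist_integral_def by (auto simp: set_lebesgue_integral_eq_integral)
qed

lemma subgradient_has_integral:
  "((\<lambda>P. dist P X - dist P m + sgn (P - m) \<bullet> (X - m)) has_integral
     (dist_integral \<Omega> X - dist_integral \<Omega> m + integral \<Omega> (\<lambda>P. sgn (P - m)) \<bullet> (X - m))) \<Omega>"
proof -
  have "((\<lambda>P. sgn (P - m) \<bullet> (X - m)) has_integral integral \<Omega> (\<lambda>P. sgn (P - m)) \<bullet> (X - m)) \<Omega>"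
    using has_integral_linear[OF integrable_integral[OF sgn_integrable_on] bounded_linear_inner_left]
    by (simp add: o_def)
  then show ?thesis
    unfolding dist_integral_eq
    by (intro has_integral_add has_integral_diff integrable_integral dist_integrable_on)
qed

lemma dist_integral_subgradient:
  "dist_integral \<Omega> m - integral \<Omega> (\<lambda>P. sgn (P - m)) \<bullet> (X - m) \<le> dist_integral \<Omega> X"
  using has_integral_nonneg[OF subgradient_has_integral[of X m]] dist_subgradient(1) by fastforce

text \<open>The subgradient defect \<open>d\<close> is nonnegative on \<open>\<Omega>\<close> and
  bounded below by a positive constant on a small box in \<open>U\<close> off the line through
  \<open>m\<close> and \<open>X\<close>.\<close>

lemma dist_integral_strict_subgradient:
  assumes U: "open U" "U \<noteq> {}" "U \<subseteq> \<Omega>" and "X \<noteq> m"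
  shows "dist_integral \<Omega> m - integral \<Omega> (\<lambda>P. sgn (P - m)) \<bullet> (X - m) < dist_integral \<Omega> X"
proof -
  define d where "d P = dist P X - dist P m + sgn (P - m) \<bullet> (X - m)" for P
  define W where "W = U \<inter> {P. Im (cnj (P - m) * (X - m)) \<noteq> 0}"
  have "open W"
    unfolding W_def
    by (intro open_Int U open_Collect_neq continuous_intros)
  obtain P0 where "P0 \<in> W"
  proof -
    obtain Q where Q: "Q \<in> U" using U by blast
    show thesis
    proof (cases "Im (cnj (Q - m) * (X - m)) = 0")
      case True
      obtain e where e: "e > 0" "ball Q e \<subseteq> U"
        using U(1) Q open_contains_ball by blast
      \<comment> \<open>A point on the line is moved perpendicularly by \<open>e / 2\<close>,
        staying in \<open>ball Q e\<close>; this changes the determinant from 0 to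
        \<open>- s * (norm (X - m))\<^sup>2\<close>.\<close>
      define s where "s = e / (2 * norm (X - m))"
      have s: "s > 0" using e \<open>X \<noteq> m\<close> by (simp add: s_def)
      have "norm (of_real s * \<i> * (X - m)) = s * norm (X - m)"
        using s by (simp add: norm_mult)
      also have "\<dots> = e / 2"
        using \<open>X \<noteq> m\<close> by (simp add: s_def)
      finally have "norm (of_real s * \<i> * (X - m)) = e / 2" .
      then have "Q + of_real s * \<i> * (X - m) \<in> U"
        using e by (intro subsetD[OF e(2)]) (simp add: dist_norm)
      moreover have "Im (cnj (Q + of_real s * \<i> * (X - m) - m) * (X - m)) = - s * (norm (X - m))\<^sup>2"
      proof -
        have "cnj (Q + of_real s * \<i> * (X - m) - m) * (X - m)
            = cnj (Q - m) * (X - m) - of_real s * \<i> * ((X - m) * cnj (X - m))"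
          by (simp add: algebra_simps)
        also have "(X - m) * cnj (X - m) = of_real ((norm (X - m))\<^sup>2)"
          by (rule complex_norm_square[symmetric])
        finally show ?thesis using True by (simp del: of_real_power)
      qed
      then have "Im (cnj (Q + of_real s * \<i> * (X - m) - m) * (X - m)) \<noteq> 0"
        using s \<open>X \<noteq> m\<close> by simp
      ultimately show thesis
        using that unfolding W_def by blast
    qed (use Q that in \<open>auto simp: W_def\<close>)
  qed
  then obtain a b where ab: "cbox a b \<subseteq> W" "P0 \<in> box a b" "\<forall>i\<in>Basis. a \<bullet> i < b \<bullet> i"
    using open_contains_cbox[OF \<open>open W\<close>] by metis
  have "m \<notin> W" by (simp add: W_def)
  then have contd: "continuous_on (cbox a b) d"
    unfolding d_def[abs_def] using ab(1) by (intro continuous_intros) auto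
  have "cbox a b \<noteq> {}"
    using ab(2) box_subset_cbox by blast
  then obtain q where q: "q \<in> cbox a b" "\<And>P. P \<in> cbox a b \<Longrightarrow> d q \<le> d P"
    using continuous_attains_inf[OF compact_cbox _ contd] by blast
  have "d q > 0"
    using q(1) ab(1) dist_subgradient(2)[of q m X] unfolding d_def W_def by blast
  have int_d: "(d has_integral
     (dist_integral \<Omega> X - dist_integral \<Omega> m + integral \<Omega> (\<lambda>P. sgn (P - m)) \<bullet> (X - m))) \<Omega>"
    using subgradient_has_integral unfolding d_def[abs_def] .
  have int_ab: "(d has_integral integral (cbox a b) d) (cbox a b)"
    by (intro integrable_integral integrable_continuous contd)
  have "0 < measure lborel (cbox a b) *\<^sub>R d q"
    using \<open>d q > 0\<close> content_pos_lt[OF ab(3)] by simp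
  also have "\<dots> \<le> integral (cbox a b) d"
    by (rule has_integral_le[OF has_integral_const int_ab q(2)])
  also have "\<dots> \<le> dist_integral \<Omega> X - dist_integral \<Omega> m + integral \<Omega> (\<lambda>P. sgn (P - m)) \<bullet> (X - m)"
  proof (rule has_integral_subset_le[OF _ int_ab int_d])
    show "cbox a b \<subseteq> \<Omega>"
      using ab(1) U(3) unfolding W_def by blast
    show "\<forall>P\<in>\<Omega>. 0 \<le> d P"
      unfolding d_def using dist_subgradient(1) by blast
  qed
  finally show ?thesis by simp
qed

text \<open>Dominated convergence with bound 1; \<open>m\<close> is removed from the domain because
  \<open>sgn\<close> is discontinuous at 0. \<open>Suc k\<close> keeps the step length finite at
  \<open>k = 0\<close>.\<close>

lemma tendsto_integral_sgn:
  "(\<lambda>k. integral \<Omega> (\<lambda>P. sgn (P - (m + v /\<^sub>R real (Suc k))))) \<longlonglongrightarrow> integral \<Omega> (\<lambda>P. sgn (P - m))"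
proof -
  define X where "X k = m + v /\<^sub>R real (Suc k)" for k
  have "(\<lambda>k. m + inverse (real (Suc k)) *\<^sub>R v) \<longlonglongrightarrow> m + 0 *\<^sub>R v"
    by (intro tendsto_intros LIMSEQ_inverse_real_of_nat)
  then have X: "X \<longlonglongrightarrow> m"
    by (simp add: X_def[abs_def])
  have neg: "negligible {m}" by simp
  have "(\<lambda>k. integral (\<Omega> - {m}) (\<lambda>P. sgn (P - X k))) \<longlonglongrightarrow> integral (\<Omega> - {m}) (\<lambda>P. sgn (P - m))"
  proof (rule dominated_convergence(2))
    show "(\<lambda>P. sgn (P - X k)) integrable_on (\<Omega> - {m})" for k
      by (rule integrable_spike_set[OF sgn_integrable_on]) (auto intro: negligible_subset[OF neg])
    show "(\<lambda>_. 1 :: real) integrable_on (\<Omega> - {m})"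
      using lmeasurable_region
      by (intro integrable_on_const fmeasurable.Diff) (auto simp: lmeasurable_compact)
    show "norm (sgn (P - X k)) \<le> 1" for k P
      by (simp add: norm_sgn)
    show "(\<lambda>k. sgn (P - X k)) \<longlonglongrightarrow> sgn (P - m)" if "P \<in> \<Omega> - {m}" for P
      using that by (intro tendsto_intros X) auto
  qed
  then show ?thesis
    by (simp add: integral_remove_finite X_def)
qed

end

theorem mainTheorem4:
  fixes \<Omega> :: "complex set" and \<Gamma> :: "(real \<Rightarrow> complex) set" and m :: complex
  assumes "plane_region \<Omega>" and "bounded \<Omega>"
    and "positively_oriented_boundary \<Omega> \<Gamma>"
  shows "is_geometric_median \<Omega> m \<longleftrightarrow> boundary_integral \<Gamma> (\<lambda>P. dist P m) = 0"
proof -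
  interpret plane_boundary \<Omega> \<Gamma>
    by unfold_locales fact+
  obtain U where U: "open U" "U \<noteq> {}" "U \<subseteq> \<Omega>"
    using assms(1) unfolding plane_region_def by blast
  define H where "H X = integral \<Omega> (\<lambda>P. sgn (P - X))" for X
  have median: "is_geometric_median \<Omega> m \<longleftrightarrow>
      {X. \<forall>Y. dist_integral \<Omega> X \<le> dist_integral \<Omega> Y} = {m}"
    unfolding is_geometric_median_def is_arg_min_def by (simp add: not_less)
  have "is_geometric_median \<Omega> m \<longleftrightarrow> H m = 0"
  proof
    assume "is_geometric_median \<Omega> m"
    then have min: "dist_integral \<Omega> m \<le> dist_integral \<Omega> Y" for Y
      unfolding median by blast
    \<comment> \<open>The test points leave \<open>m\<close> along \<open>H m\<close>, the direction
      of steepest descent of the distance integral.\<close>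
    define X where "X k = m + H m /\<^sub>R real (Suc k)" for k
    have "H (X k) \<bullet> H m \<le> 0" for k
    proof -
      \<comment> \<open>The subgradient inequality at \<open>X k\<close>, evaluated at
        \<open>m\<close>, is combined with minimality of \<open>m\<close>; the positive step length
        is then divided out.\<close>
      have "0 \<le> H (X k) \<bullet> (m - X k)"
        using dist_integral_subgradient[of "X k" m] min[of "X k"] by (simp add: H_def)
      then have "0 \<le> - (H (X k) \<bullet> H m) / real (Suc k)"
        by (simp add: X_def divide_inverse mult.commute del: of_nat_Suc)
      then show ?thesis
        by (auto simp: divide_le_0_iff)
    qed
    moreover have "(\<lambda>k. H (X k) \<bullet> H m) \<longlonglongrightarrow> H m \<bullet> H m"
      unfolding X_def H_def by (intro tendsto_intros tendsto_integral_sgn)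
    ultimately have "H m \<bullet> H m \<le> 0"
      by (intro LIMSEQ_le_const2[where X = "\<lambda>k. H (X k) \<bullet> H m"]) auto
    then show "H m = 0"
      by (metis antisym inner_eq_zero_iff inner_ge_zero)
  next
    assume "H m = 0"
    then have less: "dist_integral \<Omega> m < dist_integral \<Omega> X" if "X \<noteq> m" for X
      using dist_integral_strict_subgradient[OF U that] by (simp add: H_def)
    then have "(\<forall>Y. dist_integral \<Omega> X \<le> dist_integral \<Omega> Y) \<longleftrightarrow> X = m" for X
      by (metis less_imp_le not_less order_refl)
    then show "is_geometric_median \<Omega> m"
      unfolding median by simp
  qed
  then show ?thesis
    by (simp add: boundary_integral_dist H_def)
qed

end
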